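(* Let $\sigma$ be a weakly mixing m.p. action of a countable discrete group $\Gamma$ on a standard probability space $(X,\mu)$. Let $\mathcal W$ be a Polish group of finite type and $\mathcal V\subset\mathcal W$ a closed subgroup. If a $\mathcal V$-valued cocycle for $\sigma$ can be untwisted as a $\mathcal W$-valued cocycle (i.e. is equivalent, as a $\mathcal W$-valued cocycle, to a group morphism $\Gamma\to\mathcal W$), then it can be untwisted as a $\mathcal V$-valued cocycle (i.e. it is equivalent, as a $\mathcal V$-valued cocycle, to a group morphism $\Gamma\to\mathcal V$). More generally, let $\rho$ be another m.p. action of $\Gamma$ on a standard probability space $(Y,\nu)$. If a $\mathcal V$-valued cocycle $w$ for the diagonal product action $\sigma\times\rho$ on $(X\times Y,\mu\times\nu)$ is equivalent (as a $\mathcal W$-valued cocycle) to a $\mathcal W$-valued cocycle for $\rho$, then it is equivalent (as a $\mathcal V$-valued cocycle) to a $\mathcal V$-valued cocycle for $\rho$.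
   Context: A (right) measurable $\mathcal V$-valued cocycle for a m.p. action $\Gamma\curvearrowright(X,\mu)$ is a measurable map $w:X\times\Gamma\to\mathcal V$ such that for all $g_1,g_2\in\Gamma$, $w(t,g_1)\,w(g_1^{-1}t,g_2)=w(t,g_1g_2)$ for a.e. $t\in X$. Two $\mathcal V$-valued cocycles $w,w'$ are equivalent (as $\mathcal V$-valued cocycles) if there is a measurable $u:X\to\mathcal V$ such that for each $g\in\Gamma$, $w'(t,g)=u(t)^{-1}w(t,g)u(g^{-1}t)$ for a.e. $t$. Group morphisms are identified with cocycles independent of $t$; cocycles for $\rho$ are viewed as cocycles for $\sigma\times\rho$ independent of the $X$-variable. A Polish group is of finite type if it is isomorphic (as a Polish group) to a closed subgroup of the unitary group (with the $\|\cdot\|_2$-topology) of a separable finite von Neumann algebra, i.e. one with a faithful normal trace state $\tau$ and separable in $\|x\|_2=\tau(x^*x)^{1/2}$. *)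

theory Defs
  imports
    "HOL-Probability.Probability"
    "HOL-Algebra.Group_Action"
    "HOL-Library.Nonpos_Ints"
begin

section \<open>Finite von Neumann algebras\<close>

text \<open>The complex structure is compatible with the underlying real inner product, which supplies
  norm, positive definiteness and completeness; \<open>cinner\<close> is linear in its first argument.\<close>

class complex_hilbert_space = real_inner + complete_space +
  fixes scaleC :: "complex \<Rightarrow> 'a \<Rightarrow> 'a"
    and cinner :: "'a \<Rightarrow> 'a \<Rightarrow> complex"
  assumes scaleC_add_right: "scaleC c (x + y) = scaleC c x + scaleC c y"
    and scaleC_add_left: "scaleC (c + d) x = scaleC c x + scaleC d x"
    and scaleC_scaleC: "scaleC c (scaleC d x) = scaleC (c * d) x"
    and scaleC_of_real: "scaleC (complex_of_real r) x = r *\<^sub>R x"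
    and cinner_add_left: "cinner (x + y) z = cinner x z + cinner y z"
    and cinner_scaleC_left: "cinner (scaleC c x) y = c * cinner x y"
    and cinner_commute: "cinner x y = cnj (cinner y x)"
    and Re_cinner: "Re (cinner x y) = inner x y"

instantiation complex :: complex_hilbert_space
begin

definition "scaleC_complex (c :: complex) (z :: complex) = c * z"

definition "cinner_complex (x :: complex) (y :: complex) = x * cnj y"

instance
  by standard
    (auto simp: scaleC_complex_def cinner_complex_def inner_complex_def algebra_simps
      scaleR_conv_of_real)

end

definition bounded_operators :: "('h::complex_hilbert_space \<Rightarrow> 'h) set" where
  "bounded_operators = {x. bounded_linear x \<and> (\<forall>c v. x (scaleC c v) = scaleC c (x v))}"

definition cadjoint :: "('h::complex_hilbert_space \<Rightarrow> 'h) \<Rightarrow> ('h \<Rightarrow> 'h)" where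
  "cadjoint x = (THE y. \<forall>u v. cinner (x u) v = cinner u (y v))"

definition commutant :: "('h::complex_hilbert_space \<Rightarrow> 'h) set \<Rightarrow> ('h \<Rightarrow> 'h) set" where
  "commutant A = {x \<in> bounded_operators. \<forall>y\<in>A. x \<circ> y = y \<circ> x}"

text \<open>A self-adjoint set of bounded operators that equals its bicommutant is automatically a unital
  subalgebra.\<close>

definition von_neumann_algebra :: "('h::complex_hilbert_space \<Rightarrow> 'h) set \<Rightarrow> bool" where
  "von_neumann_algebra A \<longleftrightarrow>
     A \<subseteq> bounded_operators \<and> (\<forall>x\<in>A. cadjoint x \<in> A) \<and> commutant (commutant A) = A"

definition op_le :: "('h::complex_hilbert_space \<Rightarrow> 'h) \<Rightarrow> ('h \<Rightarrow> 'h) \<Rightarrow> bool" where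
  "op_le x y \<longleftrightarrow> (\<forall>v. cinner (y v - x v) v \<in> \<real>\<^sub>\<ge>\<^sub>0)"

text \<open>Linear functionals are total HOL functions; only their values on \<open>A\<close> matter.\<close>

definition state_on :: "('h::complex_hilbert_space \<Rightarrow> 'h) set \<Rightarrow> (('h \<Rightarrow> 'h) \<Rightarrow> complex) \<Rightarrow> bool" where
  "state_on A \<tau> \<longleftrightarrow>
     (\<forall>x\<in>A. \<forall>y\<in>A. \<tau> (\<lambda>v. x v + y v) = \<tau> x + \<tau> y) \<and>
     (\<forall>c. \<forall>x\<in>A. \<tau> (\<lambda>v. scaleC c (x v)) = c * \<tau> x) \<and>
     (\<forall>x\<in>A. \<tau> (cadjoint x \<circ> x) \<in> \<real>\<^sub>\<ge>\<^sub>0) \<and>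
     \<tau> id = 1"

text \<open>Normality: suprema of bounded increasing families of positive elements are preserved.\<close>

definition normal_on :: "('h::complex_hilbert_space \<Rightarrow> 'h) set \<Rightarrow> (('h \<Rightarrow> 'h) \<Rightarrow> complex) \<Rightarrow> bool" where
  "normal_on A \<tau> \<longleftrightarrow>
     (\<forall>D s. D \<noteq> {} \<and> D \<subseteq> A \<and> (\<forall>x\<in>D. op_le (\<lambda>_. 0) x) \<and>
        (\<forall>x\<in>D. \<forall>y\<in>D. \<exists>z\<in>D. op_le x z \<and> op_le y z) \<and>
        s \<in> A \<and> (\<forall>x\<in>D. op_le x s) \<and> (\<forall>b\<in>A. (\<forall>x\<in>D. op_le x b) \<longrightarrow> op_le s b)
        \<longrightarrow> Re (\<tau> s) = (SUP x\<in>D. Re (\<tau> x)))"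

definition faithful_normal_trace_state ::
    "('h::complex_hilbert_space \<Rightarrow> 'h) set \<Rightarrow> (('h \<Rightarrow> 'h) \<Rightarrow> complex) \<Rightarrow> bool" where
  "faithful_normal_trace_state A \<tau> \<longleftrightarrow>
     state_on A \<tau> \<and> normal_on A \<tau> \<and>
     (\<forall>x\<in>A. \<forall>y\<in>A. \<tau> (x \<circ> y) = \<tau> (y \<circ> x)) \<and>
     (\<forall>x\<in>A. \<tau> (cadjoint x \<circ> x) = 0 \<longrightarrow> x = (\<lambda>_. 0))"

definition norm2 :: "(('h::complex_hilbert_space \<Rightarrow> 'h) \<Rightarrow> complex) \<Rightarrow> ('h \<Rightarrow> 'h) \<Rightarrow> real" where
  "norm2 \<tau> x = sqrt (Re (\<tau> (cadjoint x \<circ> x)))"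

text \<open>The value 0 outside \<open>A\<close> is irrelevant, but the locale \<open>Metric_space\<close> demands
  nonnegativity and symmetry on the whole type.\<close>

definition dist2 ::
    "('h::complex_hilbert_space \<Rightarrow> 'h) set \<Rightarrow> (('h \<Rightarrow> 'h) \<Rightarrow> complex) \<Rightarrow> ('h \<Rightarrow> 'h) \<Rightarrow> ('h \<Rightarrow> 'h) \<Rightarrow> real" where
  "dist2 A \<tau> x y = (if x \<in> A \<and> y \<in> A then norm2 \<tau> (\<lambda>v. x v - y v) else 0)"

definition separable_finite_vna ::
    "('h::complex_hilbert_space \<Rightarrow> 'h) set \<Rightarrow> (('h \<Rightarrow> 'h) \<Rightarrow> complex) \<Rightarrow> bool" where
  "separable_finite_vna A \<tau> \<longleftrightarrow>
     von_neumann_algebra A \<and> faithful_normal_trace_state A \<tau> \<and>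
     separable_space (Metric_space.mtopology A (dist2 A \<tau>))"

definition unitary_group :: "('h::complex_hilbert_space \<Rightarrow> 'h) set \<Rightarrow> ('h \<Rightarrow> 'h) monoid" where
  "unitary_group A =
     \<lparr>carrier = {x \<in> A. cadjoint x \<circ> x = id \<and> x \<circ> cadjoint x = id}, mult = (\<circ>), one = id\<rparr>"

definition unitary_topology ::
    "('h::complex_hilbert_space \<Rightarrow> 'h) set \<Rightarrow> (('h \<Rightarrow> 'h) \<Rightarrow> complex) \<Rightarrow> ('h \<Rightarrow> 'h) topology" where
  "unitary_topology A \<tau> = Metric_space.mtopology (carrier (unitary_group A)) (dist2 A \<tau>)"


section \<open>Polish groups of finite type\<close>

definition polish_topology :: "'a topology \<Rightarrow> bool" where
  "polish_topology T \<longleftrightarrow> completely_metrizable_space T \<and> separable_space T"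

definition polish_group :: "'w monoid \<Rightarrow> 'w topology \<Rightarrow> bool" where
  "polish_group W T \<longleftrightarrow>
     group W \<and> topspace T = carrier W \<and> polish_topology T \<and>
     continuous_map (prod_topology T T) T (\<lambda>(x, y). x \<otimes>\<^bsub>W\<^esub> y) \<and>
     continuous_map T T (\<lambda>x. inv\<^bsub>W\<^esub> x)"

text \<open>A definition cannot quantify over the type of the Hilbert space, so that type is a parameter;
  as a premise with a free type variable, this amounts to existence of some Hilbert space.\<close>

definition finite_type :: "'h::complex_hilbert_space itself \<Rightarrow> 'w monoid \<Rightarrow> 'w topology \<Rightarrow> bool" where
  "finite_type (H :: 'h itself) W T \<longleftrightarrow>
     (\<exists>(A :: ('h \<Rightarrow> 'h) set) \<tau> K \<phi>.
        separable_finite_vna A \<tau> \<and>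
        subgroup K (unitary_group A) \<and> closedin (unitary_topology A \<tau>) K \<and>
        \<phi> \<in> iso W ((unitary_group A)\<lparr>carrier := K\<rparr>) \<and>
        homeomorphic_map T (subtopology (unitary_topology A \<tau>) K) \<phi>)"


section \<open>Measure preserving actions\<close>

definition borel_of :: "'a topology \<Rightarrow> 'a measure" where
  "borel_of T = sigma (topspace T) {U. openin T U}"

definition standard_prob_space :: "'x measure \<Rightarrow> bool" where
  "standard_prob_space M \<longleftrightarrow>
     prob_space M \<and>
     (\<exists>T. polish_topology T \<and> topspace T = space M \<and> sets M = sets (borel_of T))"

definition mp_action :: "'g monoid \<Rightarrow> 'x measure \<Rightarrow> ('g \<Rightarrow> 'x \<Rightarrow> 'x) \<Rightarrow> bool" where
  "mp_action G M \<sigma> \<longleftrightarrow>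
     group_action G (space M) \<sigma> \<and>
     (\<forall>g\<in>carrier G. \<sigma> g \<in> measurable M M \<and> distr M M (\<sigma> g) = M)"

definition weakly_mixing :: "'g monoid \<Rightarrow> 'x measure \<Rightarrow> ('g \<Rightarrow> 'x \<Rightarrow> 'x) \<Rightarrow> bool" where
  "weakly_mixing G M \<sigma> \<longleftrightarrow>
     (\<forall>F e. finite F \<and> F \<subseteq> sets M \<and> 0 < e \<longrightarrow>
        (\<exists>g\<in>carrier G. \<forall>A\<in>F. \<forall>B\<in>F.
           \<bar>measure M (A \<inter> \<sigma> g ` B) - measure M A * measure M B\<bar> < e))"

text \<open>The restriction is needed because \<open>group_action\<close> takes values in extensional bijections.\<close>

definition diag_action ::
    "'x measure \<Rightarrow> 'y measure \<Rightarrow> ('g \<Rightarrow> 'x \<Rightarrow> 'x) \<Rightarrow> ('g \<Rightarrow> 'y \<Rightarrow> 'y) \<Rightarrow> 'g \<Rightarrow> 'x \<times> 'y \<Rightarrow> 'x \<times> 'y" where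
  "diag_action M N \<sigma> \<rho> g = restrict (\<lambda>(x, y). (\<sigma> g x, \<rho> g y)) (space (M \<Otimes>\<^sub>M N))"


section \<open>Cocycles\<close>

text \<open>For a closed subgroup \<open>V\<close> of \<open>(W, T)\<close>, the notions for \<open>V\<close>-valued cocycles are those below
  for the topological group \<open>(W\<lparr>carrier := V\<rparr>, subtopology T V)\<close>.\<close>

definition cocycle ::
    "'g monoid \<Rightarrow> 'x measure \<Rightarrow> ('g \<Rightarrow> 'x \<Rightarrow> 'x) \<Rightarrow> 'w monoid \<Rightarrow> 'w topology \<Rightarrow> ('x \<times> 'g \<Rightarrow> 'w) \<Rightarrow> bool" where
  "cocycle G M \<sigma> W T w \<longleftrightarrow>
     w \<in> measurable (M \<Otimes>\<^sub>M count_space (carrier G)) (borel_of T) \<and>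
     (\<forall>g\<in>carrier G. \<forall>h\<in>carrier G.
        AE t in M. w (t, g) \<otimes>\<^bsub>W\<^esub> w (\<sigma> (inv\<^bsub>G\<^esub> g) t, h) = w (t, g \<otimes>\<^bsub>G\<^esub> h))"

definition cocycle_equiv ::
    "'g monoid \<Rightarrow> 'x measure \<Rightarrow> ('g \<Rightarrow> 'x \<Rightarrow> 'x) \<Rightarrow> 'w monoid \<Rightarrow> 'w topology \<Rightarrow>
      ('x \<times> 'g \<Rightarrow> 'w) \<Rightarrow> ('x \<times> 'g \<Rightarrow> 'w) \<Rightarrow> bool" where
  "cocycle_equiv G M \<sigma> W T w w' \<longleftrightarrow>
     (\<exists>u \<in> measurable M (borel_of T). \<forall>g\<in>carrier G.
        AE t in M. w' (t, g) = inv\<^bsub>W\<^esub> (u t) \<otimes>\<^bsub>W\<^esub> w (t, g) \<otimes>\<^bsub>W\<^esub> u (\<sigma> (inv\<^bsub>G\<^esub> g) t))"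

definition untwistable ::
    "'g monoid \<Rightarrow> 'x measure \<Rightarrow> ('g \<Rightarrow> 'x \<Rightarrow> 'x) \<Rightarrow> 'w monoid \<Rightarrow> 'w topology \<Rightarrow> ('x \<times> 'g \<Rightarrow> 'w) \<Rightarrow> bool" where
  "untwistable G M \<sigma> W T w \<longleftrightarrow> (\<exists>\<pi>\<in>hom G W. cocycle_equiv G M \<sigma> W T w (\<lambda>(t, g). \<pi> g))"

text \<open>A cocycle for \<open>\<rho>\<close> viewed as a cocycle for \<open>\<sigma> \<times> \<rho>\<close>.\<close>

definition lift_snd :: "('y \<times> 'g \<Rightarrow> 'w) \<Rightarrow> ('x \<times> 'y) \<times> 'g \<Rightarrow> 'w" where
  "lift_snd w = (\<lambda>((x, y), g). w (y, g))"

definition equiv_to_snd_cocycle ::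
    "'g monoid \<Rightarrow> 'x measure \<Rightarrow> 'y measure \<Rightarrow> ('g \<Rightarrow> 'x \<Rightarrow> 'x) \<Rightarrow> ('g \<Rightarrow> 'y \<Rightarrow> 'y) \<Rightarrow>
      'w monoid \<Rightarrow> 'w topology \<Rightarrow> (('x \<times> 'y) \<times> 'g \<Rightarrow> 'w) \<Rightarrow> bool" where
  "equiv_to_snd_cocycle G M N \<sigma> \<rho> W T w \<longleftrightarrow>
     (\<exists>w'. cocycle G N \<rho> W T w' \<and>
        cocycle_equiv G (M \<Otimes>\<^sub>M N) (diag_action M N \<sigma> \<rho>) W T w (lift_snd w'))"

end

theory Submission
  imports Defs
begin

text \<open>The metric \<open>\<parallel>x - y\<parallel>\<^sub>2\<close> on the unitary group of a finite von Neumann algebra is bi-invariant, so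
  \<open>\<W>\<close> has arbitrarily small conjugation-invariant neighbourhoods \<open>U\<close> of 1, and the open sets
  \<open>Q = \<V> U\<close> are invariant under multiplication by \<open>\<V>\<close> on both sides and intersect in \<open>\<V>\<close>. If \<open>u\<close>
  conjugates the \<open>\<V>\<close>-valued cocycle to one that does not depend on the \<open>X\<close>-variable, then
  \<open>{(s, t, y). u(s, y) u(t, y)\<^sup>-\<^sup>1 \<notin> Q}\<close> is invariant under \<open>\<sigma> \<times> \<sigma> \<times> \<rho>\<close>. Weak mixing makes its
  fibres over \<open>Y\<close> null or conull, and separability of \<open>\<W>\<close> excludes conull ones. Hence
  \<open>u(t, y) u(s, y)\<^sup>-\<^sup>1 \<in> \<V>\<close> almost everywhere; fixing one good \<open>s\<close> by Fubini, this is the \<open>\<V>\<close>-valued map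
  which untwists, and no measurable selection is needed.\<close>

section \<open>Adjoints of bounded operators\<close>

text \<open>Two points of \<open>X\<close> over the same \<open>y\<close> are compared because the
  value of \<open>u\<close> at the translated point is \<open>v \<otimes> u t \<otimes> r\<close>
  with \<open>v\<close> in \<open>V\<close> and a factor \<open>r\<close> in the large group about
  which only its independence of \<open>X\<close> is known. In the quotient \<open>q\<close> of two
  such values \<open>r\<close> disappears and \<open>v \<otimes> q \<otimes> inv v'\<close> remains,
  so the test sets must absorb \<open>V\<close> on both sides. Moving an element of \<open>V\<close>
  from the right of \<open>V U\<close> to the left conjugates \<open>U\<close>; this is why a merely
  left-invariant metric would not do. As \<open>\<rho>\<close> is arbitrary, an invariant set need
  not be null or conull as a whole, and only its fibres over \<open>Y\<close> can be controlled.
  Weak mixing passes from \<open>\<sigma>\<close> to \<open>\<sigma> \<times> \<sigma>\<close>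
  because it offers one group element for finitely many sets at once, so both coordinates can be
  served by one filter on the group. All identities hold only almost everywhere; the maps obtained
  lie in \<open>V\<close> off a null set and are redefined as \<open>\<one>\<close>
  elsewhere.\<close>

lemma parallelogram_norm:
  fixes x y :: "'a::real_inner"
  shows "(norm (x + y))\<^sup>2 + (norm (x - y))\<^sup>2 = 2 * (norm x)\<^sup>2 + 2 * (norm y)\<^sup>2"
  by (simp add: power2_norm_eq_inner inner_add_left inner_add_right inner_diff_left inner_diff_right
      inner_commute)

text \<open>The representing vector minimises \<open>\<parallel>v\<parallel>\<^sup>2 - 2 f v\<close>; minimising sequences are Cauchy by the
  parallelogram law.\<close>

lemma riesz_real:
  fixes f :: "'a::{real_inner,complete_space} \<Rightarrow> real"
  assumes "bounded_linear f"
  shows "\<exists>z. \<forall>v. f v = inner z v"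
proof -
  interpret f: bounded_linear f by fact
  obtain K where K: "\<And>v. norm (f v) \<le> norm v * K" using f.bounded by blast
  define J where "J v = (norm v)\<^sup>2 - 2 * f v" for v
  \<comment> \<open>Completing the square: \<open>f v \<le> norm v * K\<close>, and the square of
    \<open>norm v - K\<close> is nonnegative.\<close>
  have J_lower: "- K\<^sup>2 \<le> J v" for v
  proof -
    have "f v \<le> norm v * K" using K[of v] by auto
    then show ?thesis using zero_le_power2[of "norm v - K"]
      unfolding J_def power2_diff by linarith
  qed
  define m where "m = Inf (range J)"
  have bdd: "bdd_below (range J)" using J_lower by (auto simp: bdd_below_def)
  have m_le: "m \<le> J v" for v unfolding m_def by (rule cInf_lower) (use bdd in auto)
  have "\<exists>v. J v < m + 1 / Suc n" for n
    using cInf_lessD[of "range J" "m + 1 / Suc n"] unfolding m_def by auto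
  then obtain v where v: "\<And>n. J (v n) < m + 1 / Suc n" by metis
  \<comment> \<open>By the parallelogram law the right side exceeds the left by four times
    \<open>J ((1/2) *\<^sub>R (x + y)) - m\<close>, so points with nearly minimal value of
    \<open>J\<close> are close together.\<close>
  have mid: "(norm (x - y))\<^sup>2 \<le> 2 * (J x - m) + 2 * (J y - m)" for x y
  proof -
    have "J ((1/2) *\<^sub>R (x + y)) = (norm (x + y))\<^sup>2 / 4 - f x - f y"
      unfolding J_def norm_scaleR
      by (simp add: f.add f.scaleR power_mult_distrib power2_eq_square field_simps del: scaleR_add_right)
    then show ?thesis using m_le[of "(1/2) *\<^sub>R (x + y)"] parallelogram_norm[of x y]
      unfolding J_def by argo
  qed
  have "Cauchy v"
  proof (rule metric_CauchyI)
    fix e :: real assume "0 < e"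
    \<comment> \<open>\<open>mid\<close> bounds the squared distance by twice the sum of two errors
      below \<open>1 / Suc k\<close>, hence the 4.\<close>
    obtain k where k: "4 / Suc k < e\<^sup>2"
    proof -
      obtain n where "4 / e\<^sup>2 < real n" using reals_Archimedean2 by blast
      then have "4 < real (Suc n) * e\<^sup>2" using \<open>0 < e\<close> by (simp add: field_simps)
        (smt (verit) zero_less_power)
      then show ?thesis by (intro that[of n]) (simp add: field_simps)
    qed
    show "\<exists>M. \<forall>i\<ge>M. \<forall>j\<ge>M. dist (v i) (v j) < e"
    proof (intro exI[of _ k] allI impI)
      fix i j assume ij: "k \<le> i" "k \<le> j"
      have le: "1 / real (Suc n) \<le> 1 / real (Suc k)" if "k \<le> n" for n
        using that by (simp add: frac_le)
      have "(norm (v i - v j))\<^sup>2 < 4 / Suc k"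
        using mid[of "v i" "v j"] v[of i] v[of j] le[OF ij(1)] le[OF ij(2)] by argo
      then have "(norm (v i - v j))\<^sup>2 < e\<^sup>2" using k by linarith
      then show "dist (v i) (v j) < e" using \<open>0 < e\<close>
        by (simp add: dist_norm power_less_imp_less_base)
    qed
  qed
  then obtain z where z: "v \<longlonglongrightarrow> z" by (meson Cauchy_convergent convergent_def)
  have "(\<lambda>n. J (v n)) \<longlonglongrightarrow> J z"
    unfolding J_def by (intro tendsto_intros f.tendsto z)
  moreover have "(\<lambda>n. m + 1 / Suc n) \<longlonglongrightarrow> m"
    using tendsto_add[OF tendsto_const LIMSEQ_inverse_real_of_nat] by (simp add: inverse_eq_divide)
  ultimately have "J z \<le> m"
    by (rule LIMSEQ_le) (use v less_imp_le in blast)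
  have min: "J z \<le> J x" for x using \<open>J z \<le> m\<close> m_le[of x] by linarith
  have "f v = inner z v" for v
  proof (rule ccontr)
    assume ne: "f v \<noteq> inner z v"
    then have v0: "v \<noteq> 0" using f.zero by auto
    define d where "d = f v - inner z v"
    \<comment> \<open>This \<open>t\<close> minimises the quadratic
      \<open>J z - 2 * t * d + t\<^sup>2 * (norm v)\<^sup>2\<close>; its minimum is below
      \<open>J z\<close> unless \<open>d = 0\<close>.\<close>
    define t where "t = d / (norm v)\<^sup>2"
    have "J (z + t *\<^sub>R v) = J z - 2 * t * d + t\<^sup>2 * (norm v)\<^sup>2"
      unfolding J_def d_def power2_norm_eq_inner
      by (simp add: f.add f.scaleR inner_add_left inner_add_right inner_commute algebra_simps power2_eq_square)
    also have "\<dots> = J z - d\<^sup>2 / (norm v)\<^sup>2"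
      unfolding t_def using v0 by (simp add: field_simps power2_eq_square)
    also have "\<dots> < J z" using v0 ne by (simp add: d_def)
    finally show False using min[of "z + t *\<^sub>R v"] by linarith
  qed
  then show ?thesis by blast
qed

lemma cinner_scaleC_right: "cinner x (scaleC c y) = cnj c * cinner x (y::'h::complex_hilbert_space)"
  by (subst cinner_commute) (simp add: cinner_scaleC_left, metis cinner_commute)

lemma cinner_add_right: "cinner x (y + z) = cinner x y + cinner x (z::'h::complex_hilbert_space)"
  by (subst cinner_commute) (simp add: cinner_add_left, metis cinner_commute)

lemma cinner_eqI:
  fixes a b :: "'h::complex_hilbert_space"
  assumes "\<And>u. cinner u a = cinner u b"
  shows "a = b"
proof -
  have "inner u a = inner u b" for u using assms[of u] by (metis Re_cinner)
  then show ?thesis by (metis vector_eq_rdot inner_commute)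
qed

text \<open>\<open>cadjoint\<close> is a definite description, so existence and uniqueness have to
  be supplied before it can be used. Riesz for the real inner product yields the candidate, for
  which the equation is at first known only in real parts.\<close>

lemma bounded_operators_adjoint:
  fixes x :: "'h::complex_hilbert_space \<Rightarrow> 'h"
  assumes "x \<in> bounded_operators"
  shows "cinner (x u) v = cinner u (cadjoint x v)"
proof -
  interpret x: bounded_linear x using assms by (simp add: bounded_operators_def)
  have xC: "x (scaleC c v) = scaleC c (x v)" for c v
    using assms by (simp add: bounded_operators_def)
  have "\<exists>z. \<forall>u. inner v (x u) = inner z u" for v
    by (rule riesz_real) (rule bounded_linear_compose[OF bounded_linear_inner_right x.bounded_linear_axioms])
  then obtain y where y: "\<And>u v. inner v (x u) = inner (y v) u" by metis
  have adj: "cinner (x u) v = cinner u (y v)" for u v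
  proof (rule complex_eqI)
    show Re: "Re (cinner (x u) v) = Re (cinner u (y v))" for u v
      using y by (simp add: Re_cinner inner_commute)
    \<comment> \<open>An imaginary part is the real part after multiplication by
      \<open>\<i>\<close>; complex linearity of \<open>x\<close> lets this factor be moved into
      \<open>u\<close>.\<close>
    have Im: "Im (cinner a b) = - Re (cinner (scaleC \<i> a) b)" for a b :: 'h
      by (simp add: cinner_scaleC_left)
    show "Im (cinner (x u) v) = Im (cinner u (y v))"
      using Re[of "scaleC \<i> u" v] by (simp add: Im xC)
  qed
  have "\<forall>u v. cinner (x u) v = cinner u (cadjoint x v)"
    unfolding cadjoint_def
  proof (rule theI[where a=y])
    show "\<forall>u v. cinner (x u) v = cinner u (y v)" using adj by blast
    fix z assume "\<forall>u v. cinner (x u) v = cinner u (z v)"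
    then show "z = y" using adj by (metis cinner_eqI ext)
  qed
  then show ?thesis by blast
qed

lemma cadjoint_eqI:
  fixes x y :: "'h::complex_hilbert_space \<Rightarrow> 'h"
  assumes "x \<in> bounded_operators" "\<And>u v. cinner (x u) v = cinner u (y v)"
  shows "cadjoint x = y"
  using bounded_operators_adjoint[OF assms(1)] assms(2) by (metis cinner_eqI ext)

lemma id_bounded_operator: "id \<in> bounded_operators"
  by (simp add: bounded_operators_def bounded_linear_ident id_def)

lemma bounded_operators_comp:
  "\<lbrakk>x \<in> bounded_operators; y \<in> bounded_operators\<rbrakk> \<Longrightarrow> x \<circ> y \<in> bounded_operators"
  by (auto simp: bounded_operators_def comp_def intro: bounded_linear_compose)

lemma bounded_operators_add:
  "\<lbrakk>x \<in> bounded_operators; y \<in> bounded_operators\<rbrakk> \<Longrightarrow> (\<lambda>v. x v + y v) \<in> bounded_operators"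
  by (auto simp: bounded_operators_def scaleC_add_right intro: bounded_linear_add)

lemma scaleC_scaleR: "scaleC c (r *\<^sub>R v) = r *\<^sub>R scaleC c (v::'h::complex_hilbert_space)"
  by (simp flip: scaleC_of_real add: scaleC_scaleC mult.commute)

text \<open>The class postulates homogeneity of the norm for real scalars only. The complex case
  follows from sesquilinearity and gives the bound for complex multiples of bounded
  operators.\<close>

lemma norm_scaleC: "norm (scaleC c (v::'h::complex_hilbert_space)) = cmod c * norm v"
proof -
  have "cinner (scaleC c v) (scaleC c v) = (c * cnj c) * cinner v v"
    by (simp add: cinner_scaleC_left cinner_scaleC_right)
  also have "c * cnj c = complex_of_real ((cmod c)\<^sup>2)" by (metis complex_norm_square)
  finally have "Re (cinner (scaleC c v) (scaleC c v)) = (cmod c)\<^sup>2 * Re (cinner v v)" by simp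
  then have "(norm (scaleC c v))\<^sup>2 = (cmod c * norm v)\<^sup>2"
    by (simp add: Re_cinner power2_norm_eq_inner power_mult_distrib)
  then show ?thesis by (metis norm_ge_zero mult_nonneg_nonneg power2_eq_iff_nonneg)
qed

lemma bounded_operators_scaleC:
  assumes x: "x \<in> bounded_operators"
  shows "(\<lambda>v. scaleC c (x v)) \<in> bounded_operators"
proof -
  interpret x: bounded_linear x using x by (simp add: bounded_operators_def)
  obtain K where K: "\<And>v. norm (x v) \<le> norm v * K" using x.bounded by blast
  have "bounded_linear (\<lambda>v. scaleC c (x v))"
  proof (rule bounded_linear_intro[where K="cmod c * K"])
    show "norm (scaleC c (x v)) \<le> norm v * (cmod c * K)" for v
      using mult_left_mono[OF K[of v], of "cmod c"] by (simp add: norm_scaleC mult_ac)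
  qed (simp_all add: x.add x.scaleR scaleC_add_right scaleC_scaleR)
  then show ?thesis using x by (simp add: bounded_operators_def scaleC_scaleC mult.commute)
qed

lemma bounded_operators_simps:
  assumes "x \<in> bounded_operators"
  shows "x (u + v) = x u + x v" and "x (scaleC c v) = scaleC c (x v)" and "x (u - v) = x u - x v"
  using assms by (auto simp: bounded_operators_def bounded_linear.linear linear_add linear_diff)

section \<open>Closure properties of a von Neumann algebra\<close>

context
  fixes A :: "('h::complex_hilbert_space \<Rightarrow> 'h) set"
  assumes vna: "von_neumann_algebra A"
begin

lemma vna_bounded: "x \<in> A \<Longrightarrow> x \<in> bounded_operators"
  using vna by (auto simp: von_neumann_algebra_def)

lemma vna_cadjoint: "x \<in> A \<Longrightarrow> cadjoint x \<in> A"
  using vna by (auto simp: von_neumann_algebra_def)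

text \<open>One inclusion of the bicommutant equation. It reduces each closure property of
  \<open>A\<close> to the fact that operators built from members of \<open>A\<close> still commute
  with \<open>commutant A\<close>.\<close>

lemma vna_memI:
  assumes "x \<in> bounded_operators" "\<And>y. y \<in> commutant A \<Longrightarrow> x \<circ> y = y \<circ> x"
  shows "x \<in> A"
  using vna assms unfolding von_neumann_algebra_def commutant_def by blast

lemma vna_commute: "\<lbrakk>x \<in> A; y \<in> commutant A\<rbrakk> \<Longrightarrow> x (y v) = y (x v)"
  unfolding commutant_def by (auto simp: fun_eq_iff)

lemma commutant_bounded: "y \<in> commutant A \<Longrightarrow> y \<in> bounded_operators"
  unfolding commutant_def by auto

lemma vna_id: "id \<in> A"
  by (rule vna_memI) (auto simp: id_bounded_operator)

lemma vna_comp: "\<lbrakk>x \<in> A; y \<in> A\<rbrakk> \<Longrightarrow> x \<circ> y \<in> A"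
  by (rule vna_memI) (auto simp: vna_bounded bounded_operators_comp fun_eq_iff vna_commute)

lemma vna_add: "\<lbrakk>x \<in> A; y \<in> A\<rbrakk> \<Longrightarrow> (\<lambda>v. x v + y v) \<in> A"
  by (rule vna_memI)
    (auto simp: vna_bounded bounded_operators_add fun_eq_iff vna_commute
      bounded_operators_simps commutant_bounded)

lemma vna_scaleC: "x \<in> A \<Longrightarrow> (\<lambda>v. scaleC c (x v)) \<in> A"
  by (rule vna_memI)
    (auto simp: vna_bounded bounded_operators_scaleC fun_eq_iff vna_commute
      bounded_operators_simps commutant_bounded)

end

lemma scaleC_minus_one [simp]: "scaleC (-1) v = - (v::'h::complex_hilbert_space)"
  using scaleC_of_real[of "-1" v] by simp

lemma scaleC_one [simp]: "scaleC 1 v = (v::'h::complex_hilbert_space)"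
  using scaleC_of_real[of 1 v] by simp

lemma unitary_carrier:
  "x \<in> carrier (unitary_group A) \<longleftrightarrow> x \<in> A \<and> cadjoint x \<circ> x = id \<and> x \<circ> cadjoint x = id"
  by (simp add: unitary_group_def)

lemma unitary_inverse:
  assumes "u \<in> carrier (unitary_group A)"
  shows "cadjoint u (u v) = v" and "u (cadjoint u v) = v"
  using assms unfolding unitary_carrier by (metis comp_apply id_apply)+

lemma cadjoint_comp:
  assumes "x \<in> bounded_operators" "y \<in> bounded_operators"
  shows "cadjoint (x \<circ> y) = cadjoint y \<circ> cadjoint x"
  by (rule cadjoint_eqI) (simp_all add: assms bounded_operators_comp bounded_operators_adjoint)

lemma cadjoint_add_scaleC:
  assumes "x \<in> bounded_operators" "y \<in> bounded_operators"
  shows "cadjoint (\<lambda>v. x v + scaleC c (y v)) = (\<lambda>v. cadjoint x v + scaleC (cnj c) (cadjoint y v))"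
  by (rule cadjoint_eqI)
    (simp_all add: assms bounded_operators_add bounded_operators_scaleC bounded_operators_adjoint
      cinner_add_left cinner_scaleC_left cinner_add_right cinner_scaleC_right)

text \<open>The discriminant argument behind the Cauchy-Schwarz inequality: evaluate at the vertex
  \<open>t = - b / (2 * c)\<close>. The polynomial will be the square of \<open>norm2\<close> along
  \<open>x + t y\<close>, with \<open>b\<close> the sum of the two cross terms.\<close>

lemma real_quadratic_nonneg:
  fixes a b c :: real
  assumes nonneg: "\<And>t. 0 \<le> a + t * b + t\<^sup>2 * c" and "0 \<le> c" and c0: "c = 0 \<Longrightarrow> b = 0"
  shows "b \<le> 2 * sqrt a * sqrt c"
proof (cases "c = 0")
  case True
  then show ?thesis using c0 by simp
next
  case False
  then have "0 < c" using \<open>0 \<le> c\<close> by simp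
  have "0 \<le> a" using nonneg[of 0] by simp
  have "0 \<le> a - b\<^sup>2 / (4 * c)"
    using nonneg[of "- b / (2 * c)"] \<open>0 < c\<close> by (simp add: field_simps power2_eq_square)
  then have "b\<^sup>2 \<le> 4 * a * c" using \<open>0 < c\<close> by (simp add: field_simps)
  also have "\<dots> = (2 * sqrt a * sqrt c)\<^sup>2"
    using \<open>0 \<le> a\<close> \<open>0 < c\<close> by (simp add: power_mult_distrib)
  finally show ?thesis
    by (rule power2_le_imp_le) (simp add: \<open>0 \<le> a\<close> less_imp_le[OF \<open>0 < c\<close>])
qed

section \<open>The bi-invariant metric of a unitary group\<close>

context
  fixes A :: "('h::complex_hilbert_space \<Rightarrow> 'h) set" and \<tau> :: "('h \<Rightarrow> 'h) \<Rightarrow> complex"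
  assumes vna: "von_neumann_algebra A" and trace: "faithful_normal_trace_state A \<tau>"
begin

lemma trace_add: "\<lbrakk>x \<in> A; y \<in> A\<rbrakk> \<Longrightarrow> \<tau> (\<lambda>v. x v + y v) = \<tau> x + \<tau> y"
  and trace_scaleC: "x \<in> A \<Longrightarrow> \<tau> (\<lambda>v. scaleC c (x v)) = c * \<tau> x"
  and trace_commute: "\<lbrakk>x \<in> A; y \<in> A\<rbrakk> \<Longrightarrow> \<tau> (x \<circ> y) = \<tau> (y \<circ> x)"
  and trace_faithful: "\<lbrakk>x \<in> A; \<tau> (cadjoint x \<circ> x) = 0\<rbrakk> \<Longrightarrow> x = (\<lambda>_. 0)"
  and trace_nonneg: "x \<in> A \<Longrightarrow> \<tau> (cadjoint x \<circ> x) \<in> \<real>\<^sub>\<ge>\<^sub>0"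
  using trace unfolding faithful_normal_trace_state_def state_on_def by blast+

lemma trace_Re_nonneg: "x \<in> A \<Longrightarrow> 0 \<le> Re (\<tau> (cadjoint x \<circ> x))"
  using trace_nonneg complex_nonneg_Reals_iff by blast

lemma trace_Re_zero: "\<lbrakk>x \<in> A; Re (\<tau> (cadjoint x \<circ> x)) = 0\<rbrakk> \<Longrightarrow> x = (\<lambda>_. 0)"
  using trace_nonneg[of x] trace_faithful[of x] by (simp add: complex_nonneg_Reals_iff complex_eq_iff)

lemma trace_zero: "\<tau> (\<lambda>_. 0) = 0"
proof -
  have "\<tau> (\<lambda>v. scaleC 0 (id v)) = 0" using trace_scaleC[OF vna_id[OF vna], of 0] by simp
  moreover have "scaleC 0 v = 0" for v :: 'h using scaleC_of_real[of 0 v] by simp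
  ultimately show ?thesis by simp
qed

lemma vna_add_scaleC: "\<lbrakk>x \<in> A; y \<in> A\<rbrakk> \<Longrightarrow> (\<lambda>v. x v + scaleC c (y v)) \<in> A"
  by (intro vna_add[OF vna] vna_scaleC[OF vna])

lemma vna_diff: "\<lbrakk>x \<in> A; y \<in> A\<rbrakk> \<Longrightarrow> (\<lambda>v. x v - y v) \<in> A"
  using vna_add_scaleC[of x y "-1"] by simp

text \<open>Sesquilinear expansion of the square of \<open>norm2\<close>. Real \<open>c\<close>
  gives the quadratic polynomial for the triangle inequality, \<open>c = -1\<close> the square of a
  distance.\<close>

lemma trace_square_add_scaleC:
  assumes x: "x \<in> A" and y: "y \<in> A"
  shows "\<tau> (cadjoint (\<lambda>v. x v + scaleC c (y v)) \<circ> (\<lambda>v. x v + scaleC c (y v))) =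
    \<tau> (cadjoint x \<circ> x) + c * \<tau> (cadjoint x \<circ> y) + cnj c * \<tau> (cadjoint y \<circ> x)
      + cnj c * c * \<tau> (cadjoint y \<circ> y)"
proof -
  note mem = x y vna_cadjoint[OF vna x] vna_cadjoint[OF vna y]
  note bd = mem[THEN vna_bounded[OF vna]]
  let ?xx = "cadjoint x \<circ> x" and ?xy = "cadjoint x \<circ> y"
    and ?yx = "cadjoint y \<circ> x" and ?yy = "cadjoint y \<circ> y"
  have prods: "?xx \<in> A" "?xy \<in> A" "?yx \<in> A" "?yy \<in> A"
    by (intro vna_comp[OF vna] mem)+
  have 1: "cadjoint (\<lambda>v. x v + scaleC c (y v)) \<circ> (\<lambda>v. x v + scaleC c (y v)) =
    (\<lambda>v. (?xx v + scaleC c (?xy v)) + scaleC (cnj c) (?yx v + scaleC c (?yy v)))"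
    using bd by (simp add: fun_eq_iff cadjoint_add_scaleC bounded_operators_simps)
  have 2: "\<tau> (\<lambda>v. (?xx v + scaleC c (?xy v)) + scaleC (cnj c) (?yx v + scaleC c (?yy v))) = \<tau> (\<lambda>v. ?xx v + scaleC c (?xy v)) + \<tau> (\<lambda>v. scaleC (cnj c) (?yx v + scaleC c (?yy v)))"
    by (intro trace_add vna_add_scaleC vna_scaleC[OF vna] prods)
  have 3: "\<tau> (\<lambda>v. scaleC (cnj c) (?yx v + scaleC c (?yy v))) = cnj c * \<tau> (\<lambda>v. ?yx v + scaleC c (?yy v))"
    by (intro trace_scaleC vna_add_scaleC prods)
  have 4: "\<tau> (\<lambda>v. ?yx v + scaleC c (?yy v)) = \<tau> ?yx + c * \<tau> ?yy"
    by (subst trace_add[OF prods(3) vna_scaleC[OF vna prods(4)]])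
      (simp only: trace_scaleC[OF prods(4)])
  have 5: "\<tau> (\<lambda>v. ?xx v + scaleC c (?xy v)) = \<tau> ?xx + c * \<tau> ?xy"
    by (subst trace_add[OF prods(1) vna_scaleC[OF vna prods(2)]])
      (simp only: trace_scaleC[OF prods(2)])
  show ?thesis unfolding 1 2 3 4 5 by (simp add: algebra_simps)
qed

lemma norm2_triangle:
  assumes x: "x \<in> A" and y: "y \<in> A"
  shows "norm2 \<tau> (\<lambda>v. x v + y v) \<le> norm2 \<tau> x + norm2 \<tau> y"
proof -
  let ?q = "\<lambda>x. Re (\<tau> (cadjoint x \<circ> x))"
  define b where "b = Re (\<tau> (cadjoint x \<circ> y)) + Re (\<tau> (cadjoint y \<circ> x))"
  have q: "?q (\<lambda>v. x v + scaleC (complex_of_real t) (y v)) = ?q x + t * b + t\<^sup>2 * ?q y" for t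
    by (simp add: trace_square_add_scaleC[OF x y] b_def algebra_simps power2_eq_square)
  have "b \<le> 2 * sqrt (?q x) * sqrt (?q y)"
  proof (rule real_quadratic_nonneg)
    show "0 \<le> ?q x + t * b + t\<^sup>2 * ?q y" for t
      using trace_Re_nonneg[OF vna_add_scaleC[OF x y, of "complex_of_real t"]] unfolding q .
    \<comment> \<open>Faithfulness turns a vanishing square into \<open>y = 0\<close>, and then both
      cross terms are traces of 0.\<close>
    show "b = 0" if "?q y = 0"
    proof -
      have "y = (\<lambda>_. 0)" by (rule trace_Re_zero[OF y that])
      moreover have "cadjoint (\<lambda>_. 0::'h) = (\<lambda>_. 0)"
        using cadjoint_eqI[of "\<lambda>_. 0::'h" "\<lambda>_. 0"] vna_bounded[OF vna y] \<open>y = _\<close>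
        by (metis add_cancel_right_right cinner_add_left cinner_add_right)
      moreover have "cadjoint x 0 = 0"
        using bounded_operators_simps(3)[OF vna_bounded[OF vna vna_cadjoint[OF vna x]], of 0 0] by simp
      ultimately show ?thesis by (simp add: b_def comp_def trace_zero)
    qed
  qed (use trace_Re_nonneg[OF y] in simp)
  moreover have "?q (\<lambda>v. x v + y v) = ?q x + b + ?q y"
    using q[of 1] by simp
  ultimately have "?q (\<lambda>v. x v + y v) \<le> (sqrt (?q x) + sqrt (?q y))\<^sup>2"
    using trace_Re_nonneg[OF x] trace_Re_nonneg[OF y] by (simp add: power2_sum)
  then show ?thesis
    unfolding norm2_def using trace_Re_nonneg[OF x] trace_Re_nonneg[OF y] by (intro real_le_lsqrt) auto
qed

lemma norm2_minus_commute:
  assumes x: "x \<in> A" and y: "y \<in> A"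
  shows "norm2 \<tau> (\<lambda>v. x v - y v) = norm2 \<tau> (\<lambda>v. y v - x v)"
proof -
  have 1: "Re (\<tau> (cadjoint (\<lambda>v. x v - y v) \<circ> (\<lambda>v. x v - y v))) =
      Re (\<tau> (cadjoint x \<circ> x)) - Re (\<tau> (cadjoint x \<circ> y)) - Re (\<tau> (cadjoint y \<circ> x))
      + Re (\<tau> (cadjoint y \<circ> y))" if "x \<in> A" "y \<in> A" for x y
    using arg_cong[OF trace_square_add_scaleC[OF that, of "-1"], of Re] by simp
  have 2: "Re (\<tau> (cadjoint (\<lambda>v. x v - y v) \<circ> (\<lambda>v. x v - y v))) = Re (\<tau> (cadjoint (\<lambda>v. y v - x v) \<circ> (\<lambda>v. y v - x v)))" 
    using 1[OF x y] 1[OF y x] by linarith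
  show ?thesis unfolding norm2_def 2 ..
qed

lemma Metric_space_unitary: "Metric_space (carrier (unitary_group A)) (dist2 A \<tau>)"
proof
  show "0 \<le> dist2 A \<tau> x y" for x y
    using trace_Re_nonneg[OF vna_diff[of x y]] by (simp add: dist2_def norm2_def)
  show "dist2 A \<tau> x y = dist2 A \<tau> y x" for x y
    using norm2_minus_commute[of x y] by (auto simp: dist2_def)
  fix x y assume "x \<in> carrier (unitary_group A)" and "y \<in> carrier (unitary_group A)"
  then have x: "x \<in> A" and y: "y \<in> A" by (auto simp: unitary_carrier)
  show "dist2 A \<tau> x y = 0 \<longleftrightarrow> x = y"
  proof
    assume "dist2 A \<tau> x y = 0"
    then have "(\<lambda>v. x v - y v) = (\<lambda>_. 0)"
      using x y by (intro trace_Re_zero vna_diff) (simp_all add: dist2_def norm2_def)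
    then show "x = y" by (auto simp: fun_eq_iff)
  next
    assume "x = y"
    \<comment> \<open>The zero operator is read as \<open>y - y\<close>: in the expansion with
      \<open>c = -1\<close> the four terms cancel.\<close>
    have "norm2 \<tau> (\<lambda>_. 0) = 0"
      using trace_square_add_scaleC[OF y y, of "-1"] by (simp add: norm2_def)
    then show "dist2 A \<tau> x y = 0" by (simp add: dist2_def \<open>x = y\<close>)
  qed
  fix z assume "z \<in> carrier (unitary_group A)"
  then have z: "z \<in> A" by (auto simp: unitary_carrier)
  show "dist2 A \<tau> x z \<le> dist2 A \<tau> x y + dist2 A \<tau> y z"
    using norm2_triangle[OF vna_diff[OF x y] vna_diff[OF y z]] x y z by (simp add: dist2_def)
qed

lemma dist2_mult_left:
  assumes u: "u \<in> carrier (unitary_group A)" and x: "x \<in> A" and y: "y \<in> A"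
  shows "dist2 A \<tau> (u \<circ> x) (u \<circ> y) = dist2 A \<tau> x y"
proof -
  have uA: "u \<in> A" using u by (simp add: unitary_carrier)
  define z where "z = (\<lambda>v. x v - y v)"
  have z: "z \<in> A" unfolding z_def by (rule vna_diff[OF x y])
  have "(\<lambda>v. (u \<circ> x) v - (u \<circ> y) v) = u \<circ> z"
    using vna_bounded[OF vna uA] by (simp add: fun_eq_iff z_def bounded_operators_simps)
  moreover have "cadjoint (u \<circ> z) \<circ> (u \<circ> z) = cadjoint z \<circ> z"
    by (simp add: cadjoint_comp vna_bounded[OF vna] uA z fun_eq_iff unitary_inverse[OF u])
  ultimately have "norm2 \<tau> (\<lambda>v. (u \<circ> x) v - (u \<circ> y) v) = norm2 \<tau> z"
    by (simp only: norm2_def)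
  then show ?thesis by (simp add: dist2_def vna_comp[OF vna] uA x y z_def)
qed

text \<open>A right factor does not cancel inside
  \<open>cadjoint (z \<circ> u) \<circ> (z \<circ> u)\<close>; cyclicity of the trace is what brings
  \<open>u\<close> next to \<open>cadjoint u\<close>. This is where the trace property
  enters.\<close>

lemma dist2_mult_right:
  assumes u: "u \<in> carrier (unitary_group A)" and x: "x \<in> A" and y: "y \<in> A"
  shows "dist2 A \<tau> (x \<circ> u) (y \<circ> u) = dist2 A \<tau> x y"
proof -
  have uA: "u \<in> A" using u by (simp add: unitary_carrier)
  define z where "z = (\<lambda>v. x v - y v)"
  have z: "z \<in> A" unfolding z_def by (rule vna_diff[OF x y])
  have "(\<lambda>v. (x \<circ> u) v - (y \<circ> u) v) = z \<circ> u" by (simp add: z_def fun_eq_iff)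
  moreover have "cadjoint (z \<circ> u) \<circ> (z \<circ> u) = cadjoint u \<circ> (cadjoint z \<circ> z \<circ> u)"
    by (simp add: cadjoint_comp vna_bounded[OF vna] uA z comp_assoc)
  moreover have "\<tau> (cadjoint u \<circ> (cadjoint z \<circ> z \<circ> u)) = \<tau> (cadjoint z \<circ> z \<circ> u \<circ> cadjoint u)"
    by (intro trace_commute vna_comp[OF vna] vna_cadjoint[OF vna] uA z)
  moreover have "cadjoint z \<circ> z \<circ> u \<circ> cadjoint u = cadjoint z \<circ> z"
    by (simp add: fun_eq_iff unitary_inverse[OF u])
  ultimately have "norm2 \<tau> (\<lambda>v. (x \<circ> u) v - (y \<circ> u) v) = norm2 \<tau> z"
    by (simp only: norm2_def)
  then show ?thesis by (simp add: dist2_def vna_comp[OF vna] uA x y z_def)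
qed

lemma dist2_conjugate:
  assumes u: "u \<in> carrier (unitary_group A)" and u': "u' \<in> carrier (unitary_group A)"
    and "u \<circ> u' = id" and x: "x \<in> A"
  shows "dist2 A \<tau> id (u \<circ> x \<circ> u') = dist2 A \<tau> id x"
proof -
  have uA: "u \<in> A" using u by (simp add: unitary_carrier)
  have "dist2 A \<tau> (u \<circ> id \<circ> u') (u \<circ> x \<circ> u') = dist2 A \<tau> (u \<circ> id) (u \<circ> x)"
    by (intro dist2_mult_right u' vna_comp[OF vna] uA x vna_id[OF vna])
  also have "\<dots> = dist2 A \<tau> id x" by (intro dist2_mult_left u x vna_id[OF vna])
  finally show ?thesis using assms(3) by simp
qed

end

text \<open>Groups with this property are known as SIN groups. The later arguments use it in place
  of a representation by unitaries.\<close>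

definition small_invariant_nhds :: "'w monoid \<Rightarrow> 'w topology \<Rightarrow> bool" where
  "small_invariant_nhds W T \<longleftrightarrow>
     (\<forall>Q. openin T Q \<and> \<one>\<^bsub>W\<^esub> \<in> Q \<longrightarrow>
       (\<exists>U. openin T U \<and> \<one>\<^bsub>W\<^esub> \<in> U \<and> U \<subseteq> Q \<and>
         (\<forall>a\<in>carrier W. \<forall>x\<in>U. a \<otimes>\<^bsub>W\<^esub> x \<otimes>\<^bsub>W\<^esub> inv\<^bsub>W\<^esub> a \<in> U)))"

text \<open>Balls around \<open>id\<close> are invariant under conjugation because the metric is
  bi-invariant, and their preimages under \<open>\<phi>\<close> are the required
  neighbourhoods.\<close>

lemma finite_type_small_invariant_nhds:
  assumes W: "group W" and top: "topspace T = carrier W"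
    and ft: "finite_type TYPE('h::complex_hilbert_space) W T"
  shows "small_invariant_nhds W T"
  unfolding small_invariant_nhds_def
proof (intro allI impI)
  fix Q assume Q: "openin T Q \<and> \<one>\<^bsub>W\<^esub> \<in> Q"
  interpret W: group W by fact
  obtain A :: "('h \<Rightarrow> 'h) set" and \<tau> K \<phi> where
    vna: "von_neumann_algebra A" and tr: "faithful_normal_trace_state A \<tau>"
    and K: "subgroup K (unitary_group A)"
    and iso: "\<phi> \<in> iso W ((unitary_group A)\<lparr>carrier := K\<rparr>)"
    and homeo: "homeomorphic_map T (subtopology (unitary_topology A \<tau>) K) \<phi>"
    using ft unfolding finite_type_def separable_finite_vna_def by blast
  interpret Metric_space "carrier (unitary_group A)" "dist2 A \<tau>"
    by (rule Metric_space_unitary[OF vna tr])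
  have unitop: "unitary_topology A \<tau> = mtopology" by (simp add: unitary_topology_def)
  have K_sub: "K \<subseteq> carrier (unitary_group A)" using K by (simp add: subgroup_def)
  have \<phi>K: "\<phi> x \<in> K" if "x \<in> carrier W" for x
    using iso that by (auto simp: iso_def hom_def)
  have \<phi>_mult: "\<phi> (x \<otimes>\<^bsub>W\<^esub> y) = \<phi> x \<circ> \<phi> y" if "x \<in> carrier W" "y \<in> carrier W" for x y
    using iso that by (auto simp: iso_def hom_def unitary_group_def)
  have \<phi>_inj: "inj_on \<phi> (carrier W)" using iso by (auto simp: iso_def bij_betw_def)
  have \<phi>A: "\<phi> x \<in> carrier (unitary_group A)" if "x \<in> carrier W" for x using \<phi>K[OF that] K_sub by blast
  \<comment> \<open>The image of the unit is an idempotent unitary, and its adjoint cancels one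
    factor.\<close>
  have \<phi>_one: "\<phi> \<one>\<^bsub>W\<^esub> = id"
  proof -
    have "\<phi> \<one>\<^bsub>W\<^esub> \<circ> \<phi> \<one>\<^bsub>W\<^esub> = \<phi> \<one>\<^bsub>W\<^esub>" using \<phi>_mult[of "\<one>\<^bsub>W\<^esub>" "\<one>\<^bsub>W\<^esub>"] by simp
    then have "cadjoint (\<phi> \<one>\<^bsub>W\<^esub>) \<circ> \<phi> \<one>\<^bsub>W\<^esub> \<circ> \<phi> \<one>\<^bsub>W\<^esub> = cadjoint (\<phi> \<one>\<^bsub>W\<^esub>) \<circ> \<phi> \<one>\<^bsub>W\<^esub>"
      by (simp add: comp_assoc)
    then show ?thesis using \<phi>A[of "\<one>\<^bsub>W\<^esub>"] by (simp add: unitary_carrier)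
  qed
  have id_mem: "id \<in> carrier (unitary_group A)" using \<phi>A[of "\<one>\<^bsub>W\<^esub>"] \<phi>_one by simp
  \<comment> \<open>The homeomorphism reaches only \<open>K\<close>, so the image of
    \<open>Q\<close> is the trace on \<open>K\<close> of an open set \<open>S\<close>; a radius is
    then chosen inside \<open>S\<close>.\<close>
  have "openin (subtopology mtopology K) (\<phi> ` Q)"
    using homeo Q unfolding unitop by (metis homeomorphic_imp_open_map open_map_def)
  then obtain S where S: "openin mtopology S" "\<phi> ` Q = S \<inter> K" by (auto simp: openin_subtopology)
  have "id \<in> S" using S(2) Q \<phi>_one by (metis IntD1 imageI)
  then obtain r where r: "r > 0" "mball id r \<subseteq> S" using S(1) by (auto simp: openin_mtopology)
  define U where "U = {x \<in> carrier W. \<phi> x \<in> mball id r}"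
  have cont: "continuous_map T mtopology \<phi>"
    using homeo unfolding unitop
    by (metis homeomorphic_imp_continuous_map continuous_map_in_subtopology)
  have "openin T U"
    using openin_continuous_map_preimage[OF cont openin_mball[of id r]] by (simp add: U_def top)
  moreover have "\<one>\<^bsub>W\<^esub> \<in> U" using r id_mem by (simp add: U_def \<phi>_one)
  moreover have "U \<subseteq> Q"
  proof
    fix x assume "x \<in> U"
    then have x: "x \<in> carrier W" "\<phi> x \<in> S \<inter> K" using r \<phi>K by (auto simp: U_def)
    then obtain y where "y \<in> Q" "\<phi> x = \<phi> y" using S(2) by blast
    moreover have "y \<in> carrier W" using Q \<open>y \<in> Q\<close> top openin_subset by blast
    ultimately show "x \<in> Q" using \<phi>_inj x by (metis inj_onD)
  qed
  moreover have "a \<otimes>\<^bsub>W\<^esub> x \<otimes>\<^bsub>W\<^esub> inv\<^bsub>W\<^esub> a \<in> U" if a: "a \<in> carrier W" and "x \<in> U" for a x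
  proof -
    have x: "x \<in> carrier W" "dist2 A \<tau> id (\<phi> x) < r" using that by (auto simp: U_def)
    have "\<phi> a \<circ> \<phi> (inv\<^bsub>W\<^esub> a) = id" using a \<phi>_mult[of a "inv\<^bsub>W\<^esub> a"] \<phi>_one by simp
    then have "dist2 A \<tau> id (\<phi> a \<circ> \<phi> x \<circ> \<phi> (inv\<^bsub>W\<^esub> a)) = dist2 A \<tau> id (\<phi> x)"
      using a x \<phi>A[of a] \<phi>A[of x] \<phi>A[of "inv\<^bsub>W\<^esub> a"]
      by (intro dist2_conjugate[OF vna tr]) (auto simp: unitary_carrier)
    then show ?thesis
      using a x \<phi>A[of "a \<otimes>\<^bsub>W\<^esub> x \<otimes>\<^bsub>W\<^esub> inv\<^bsub>W\<^esub> a"] id_mem by (simp add: U_def \<phi>_mult)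
  qed
  ultimately show "\<exists>U. openin T U \<and> \<one>\<^bsub>W\<^esub> \<in> U \<and> U \<subseteq> Q \<and>
         (\<forall>a\<in>carrier W. \<forall>x\<in>U. a \<otimes>\<^bsub>W\<^esub> x \<otimes>\<^bsub>W\<^esub> inv\<^bsub>W\<^esub> a \<in> U)"
    by blast
qed

section \<open>Relative mixing\<close>

text \<open>The sets along which \<open>\<Delta>\<close> tends to 0 form a Dynkin system. Countable
  disjoint unions need a tail estimate uniform in \<open>g\<close>, which domination by one finite
  measure provides; the filter may then be arbitrary. It will be applied to each argument of a
  biadditive \<open>\<Delta>\<close> in turn.\<close>

lemma tendsto_zero_Int_stable_generator:
  fixes R :: "'a measure" and \<Delta> :: "'i \<Rightarrow> 'a set \<Rightarrow> real"
  assumes "finite_measure R"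
    and sets: "sets R = sigma_sets (space R) \<G>" and stable: "Int_stable \<G>" and sub: "\<G> \<subseteq> Pow (space R)"
    and index: "\<forall>\<^sub>F g in \<Phi>. g \<in> I"
    and add: "\<And>g A B. \<lbrakk>g \<in> I; A \<in> sets R; B \<in> sets R; A \<inter> B = {}\<rbrakk> \<Longrightarrow> \<Delta> g (A \<union> B) = \<Delta> g A + \<Delta> g B"
    and bound: "\<And>g A. \<lbrakk>g \<in> I; A \<in> sets R\<rbrakk> \<Longrightarrow> \<bar>\<Delta> g A\<bar> \<le> measure R A"
    and space: "((\<lambda>g. \<Delta> g (space R)) \<longlongrightarrow> 0) \<Phi>"
    and gen: "\<And>A. A \<in> \<G> \<Longrightarrow> ((\<lambda>g. \<Delta> g A) \<longlongrightarrow> 0) \<Phi>"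
    and "A \<in> sets R"
  shows "((\<lambda>g. \<Delta> g A) \<longlongrightarrow> 0) \<Phi>"
proof -
  interpret finite_measure R by fact
  have union_lim: "((\<lambda>g. \<Delta> g (A \<union> B)) \<longlongrightarrow> 0) \<Phi>"
    if "((\<lambda>g. \<Delta> g A) \<longlongrightarrow> 0) \<Phi>" "((\<lambda>g. \<Delta> g B) \<longlongrightarrow> 0) \<Phi>"
      "A \<in> sets R" "B \<in> sets R" "A \<inter> B = {}" for A B
  proof -
    have "\<forall>\<^sub>F g in \<Phi>. \<Delta> g A + \<Delta> g B = \<Delta> g (A \<union> B)"
      using index by eventually_elim (use add that in simp)
    with tendsto_add[OF that(1,2)] show ?thesis using Lim_transform_eventually by fastforce
  qed
  have empty: "((\<lambda>g. \<Delta> g {}) \<longlongrightarrow> 0) \<Phi>"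
  proof -
    have "\<forall>\<^sub>F g in \<Phi>. 0 = \<Delta> g {}"
      using index by eventually_elim (use bound[of _ "{}"] in force)
    with tendsto_const show ?thesis by (rule Lim_transform_eventually)
  qed
  have "A \<in> sigma_sets (space R) \<G>" using \<open>A \<in> sets R\<close> sets by simp
  with stable sub show ?thesis
  proof (induction rule: sigma_sets_induct_disjoint)
    case (basic A) then show ?case by (rule gen)
  next
    case empty show ?case by (rule \<open>((\<lambda>g. \<Delta> g {}) \<longlongrightarrow> 0) \<Phi>\<close>)
  next
    case (compl A)
    then have A: "A \<in> sets R" by (simp add: sets)
    have "\<forall>\<^sub>F g in \<Phi>. \<Delta> g (space R) - \<Delta> g A = \<Delta> g (space R - A)"
      using index
    proof eventually_elim
      fix g assume "g \<in> I"
      then have "\<Delta> g (A \<union> (space R - A)) = \<Delta> g A + \<Delta> g (space R - A)"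
        by (rule add) (use A in auto)
      moreover have "A \<union> (space R - A) = space R" using sets.sets_into_space[OF A] by blast
      ultimately show "\<Delta> g (space R) - \<Delta> g A = \<Delta> g (space R - A)" by simp
    qed
    with tendsto_diff[OF space compl.IH] show ?case using Lim_transform_eventually by fastforce
  next
    case (union A)
    have A: "A i \<in> sets R" for i using union(2) by (auto simp: sets)
    define P where "P n = (\<Union>i<n. A i)" for n
    have P: "P n \<in> sets R" for n using A by (auto simp: P_def)
    have UA: "(\<Union>i. A i) \<in> sets R" using A by auto
    have P_lim: "((\<lambda>g. \<Delta> g (P n)) \<longlongrightarrow> 0) \<Phi>" for n
    proof (induction n)
      case 0 show ?case using empty by (simp add: P_def)
    next
      case (Suc n)
      have "P (Suc n) = P n \<union> A n" by (auto simp: P_def lessThan_Suc)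
      moreover have "P n \<inter> A n = {}"
        using disjoint_family_onD[OF union(1) UNIV_I UNIV_I, of _ n] by (force simp: P_def)
      ultimately show ?case using union_lim[OF Suc union.IH[of n] P A] by simp
    qed
    show ?case
    proof (rule tendstoI)
      fix e :: real assume "0 < e"
      have "incseq P" unfolding P_def by (intro monoI UN_mono) auto
      moreover have "range P \<subseteq> sets R" using P by auto
      ultimately have "(\<lambda>n. measure R (P n)) \<longlonglongrightarrow> measure R (\<Union>n. P n)"
        by (intro finite_Lim_measure_incseq)
      moreover have "(\<Union>n. P n) = (\<Union>i. A i)" by (auto simp: P_def)
      ultimately have "(\<lambda>n. measure R (P n)) \<longlonglongrightarrow> measure R (\<Union>i. A i)" by simp
      then have "\<forall>\<^sub>F n in sequentially. dist (measure R (P n)) (measure R (\<Union>i. A i)) < e / 2"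
        using \<open>0 < e\<close> by (intro tendstoD) auto
      \<comment> \<open>\<open>n\<close> depends on \<open>e\<close> but not on \<open>g\<close>:
        the sets from index \<open>n\<close> on contribute less than \<open>e / 2\<close> to every
        \<open>\<Delta> g\<close> with \<open>g \<in> I\<close>.\<close>
      then obtain n where n: "dist (measure R (P n)) (measure R (\<Union>i. A i)) < e / 2"
        using eventually_happens'[OF sequentially_bot] by blast
      let ?Q = "(\<Union>i. A i) - P n"
      have P_sub: "P n \<subseteq> (\<Union>i. A i)" by (auto simp: P_def)
      have "measure R ?Q = measure R (\<Union>i. A i) - measure R (P n)"
        by (rule finite_measure_Diff[OF UA P P_sub])
      then have small: "measure R ?Q < e / 2" using n unfolding dist_real_def by linarith
      have "\<forall>\<^sub>F g in \<Phi>. dist (\<Delta> g (P n)) 0 < e / 2"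
        using \<open>0 < e\<close> by (intro tendstoD P_lim) auto
      with index show "\<forall>\<^sub>F g in \<Phi>. dist (\<Delta> g (\<Union>i. A i)) 0 < e"
      proof eventually_elim
        fix g assume g: "g \<in> I" and d: "dist (\<Delta> g (P n)) 0 < e / 2"
        have "\<Delta> g (P n \<union> ?Q) = \<Delta> g (P n) + \<Delta> g ?Q" by (rule add[OF g]) (use P UA in auto)
        moreover have "P n \<union> ?Q = (\<Union>i. A i)" using P_sub by blast
        moreover have "\<bar>\<Delta> g ?Q\<bar> \<le> measure R ?Q" by (rule bound[OF g]) (use P UA in auto)
        ultimately show "dist (\<Delta> g (\<Union>i. A i)) 0 < e" using d small by (simp add: dist_real_def)
      qed
    qed
  qed
qed

section \<open>Invariant sets in a product whose first factor is mixing\<close>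

context
  fixes Z :: "'z measure" and N :: "'y measure"
  assumes Z: "prob_space Z" and N: "prob_space N"
begin

interpretation Z: prob_space Z by (rule Z)
interpretation N: prob_space N by (rule N)
interpretation ZN: pair_prob_space Z N ..

lemma measure_Times: "\<lbrakk>A \<in> sets Z; B \<in> sets N\<rbrakk> \<Longrightarrow>
    measure (Z \<Otimes>\<^sub>M N) (A \<times> B) = measure Z A * measure N B"
  by (simp add: measure_def N.emeasure_pair_measure_Times enn2real_mult)

lemma section_measurable:
  assumes "D \<in> sets (Z \<Otimes>\<^sub>M N)"
  shows "(\<lambda>y. measure Z ((\<lambda>z. (z, y)) -` D)) \<in> borel_measurable N"
  unfolding measure_def using ZN.measurable_emeasure_Pair2[OF assms] by simp

lemma integral_section:
  assumes D: "D \<in> sets (Z \<Otimes>\<^sub>M N)"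
  shows "(\<integral>y. measure Z ((\<lambda>z. (z, y)) -` D) \<partial>N) = measure (Z \<Otimes>\<^sub>M N) D"
proof -
  have "(\<integral>y. measure Z ((\<lambda>z. (z, y)) -` D) \<partial>N)
      = enn2real (\<integral>\<^sup>+y. ennreal (measure Z ((\<lambda>z. (z, y)) -` D)) \<partial>N)"
    by (rule integral_eq_nn_integral) (auto intro: section_measurable[OF D])
  also have "\<dots> = enn2real (\<integral>\<^sup>+y. emeasure Z ((\<lambda>z. (z, y)) -` D) \<partial>N)"
    by (simp add: Z.emeasure_eq_measure)
  also have "\<dots> = measure (Z \<Otimes>\<^sub>M N) D"
    by (simp add: measure_def ZN.emeasure_pair_measure_alt2[OF D])
  finally show ?thesis .
qed

text \<open>The sets \<open>E\<close> and \<open>g E\<close> become asymptotically independent relative to the second factor, so the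
  measure of an invariant set \<open>E\<close> is at most \<open>\<integral> m\<^sup>2\<close>, where \<open>m y\<close> is the measure of the fibre over
  \<open>y\<close>, whereas \<open>\<integral> m\<close> equals the measure of \<open>E\<close>.\<close>

lemma mixing_invariant_fibres:
  fixes a :: "'i \<Rightarrow> 'z \<Rightarrow> 'z" and b :: "'i \<Rightarrow> 'y \<Rightarrow> 'y"
  assumes \<Phi>: "\<Phi> \<noteq> bot" and index: "\<forall>\<^sub>F g in \<Phi>. g \<in> I"
    and a [measurable]: "\<And>g. g \<in> I \<Longrightarrow> a g \<in> measurable Z Z" and a_mp: "\<And>g. g \<in> I \<Longrightarrow> distr Z Z (a g) = Z"
    and b [measurable]: "\<And>g. g \<in> I \<Longrightarrow> b g \<in> measurable N N" and b_mp: "\<And>g. g \<in> I \<Longrightarrow> distr N N (b g) = N"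
    and gen: "sets Z = sigma_sets (space Z) \<G>" "Int_stable \<G>" "\<G> \<subseteq> Pow (space Z)" "space Z \<in> \<G>"
    and mix: "\<And>A B. \<lbrakk>A \<in> \<G>; B \<in> \<G>\<rbrakk> \<Longrightarrow>
      ((\<lambda>g. measure Z (A \<inter> (a g -` B \<inter> space Z))) \<longlongrightarrow> measure Z A * measure Z B) \<Phi>"
    and E: "E \<in> sets (Z \<Otimes>\<^sub>M N)"
    and inv: "\<And>g. g \<in> I \<Longrightarrow> AE (z, y) in Z \<Otimes>\<^sub>M N. (a g z, b g y) \<in> E \<longleftrightarrow> (z, y) \<in> E"
  shows "AE y in N. measure Z ((\<lambda>z. (z, y)) -` E) \<in> {0, 1}"
proof -
  let ?R = "Z \<Otimes>\<^sub>M N"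
  define m where "m D y = measure Z ((\<lambda>z. (z, y)) -` D)" for D and y :: 'y
  define T where "T g = (\<lambda>(z, y). (a g z, b g y))" for g
  \<comment> \<open>The deviation from independence relative to the second factor: over
    \<open>y\<close>, the fibres of \<open>D\<close> and of the preimage of \<open>E\<close> have
    measures \<open>m D y\<close> and \<open>m E (b g y)\<close>, so the integral of the product is
    the value expected under conditional independence.\<close>
  define \<Delta> where "\<Delta> g D E = measure ?R (D \<inter> (T g -` E \<inter> space ?R)) - (\<integral>y. m D y * m E (b g y) \<partial>N)"
    for g D E
  have m_meas [measurable]: "D \<in> sets ?R \<Longrightarrow> m D \<in> borel_measurable N" for D
    unfolding m_def by (rule section_measurable)
  have m_nonneg: "0 \<le> m D y" and m_le_1: "m D y \<le> 1" for D y by (simp_all add: m_def)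
  have m_int: "D \<in> sets ?R \<Longrightarrow> (\<integral>y. m D y \<partial>N) = measure ?R D" for D
    unfolding m_def by (rule integral_section)
  have T_meas: "g \<in> I \<Longrightarrow> T g \<in> measurable ?R ?R" for g unfolding T_def by measurable
  have T_mp: "distr ?R ?R (T g) = ?R" if "g \<in> I" for g
    unfolding T_def using pair_measure_distr[OF a[OF that] b[OF that]] a_mp[OF that] b_mp[OF that]
      N.sigma_finite_measure_axioms by simp
  have T_pre: "T g -` D \<inter> space ?R \<in> sets ?R" if "g \<in> I" "D \<in> sets ?R" for g D
    using measurable_sets[OF T_meas[OF that(1)] that(2)] .
  have T_measure: "measure ?R (T g -` D \<inter> space ?R) = measure ?R D" if "g \<in> I" "D \<in> sets ?R" for g D
    using measure_distr[OF T_meas[OF that(1)] that(2)] T_mp[OF that(1)] by simp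
  have mb_int: "(\<integral>y. m D (b g y) \<partial>N) = measure ?R D" if "g \<in> I" "D \<in> sets ?R" for g D
    using integral_distr[OF b[OF that(1)] m_meas[OF that(2)]] b_mp[OF that(1)] m_int[OF that(2)] by simp
  have prod_le: "m D y * m E y' \<le> m D y" "m D y * m E y' \<le> m E y'" for D E y y'
    using m_nonneg m_le_1 by (auto intro: mult_right_le_one_le mult_left_le_one_le)
  have abs_m: "\<bar>m D y\<bar> = m D y" for D y using m_nonneg by simp
  have integrable_m: "D \<in> sets ?R \<Longrightarrow> integrable N (m D)" for D
    by (rule N.integrable_const_bound[where B=1]) (auto simp: abs_m m_le_1)
  have integrable_mb: "\<lbrakk>g \<in> I; D \<in> sets ?R\<rbrakk> \<Longrightarrow> integrable N (\<lambda>y. m D (b g y))" for g D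
    by (rule N.integrable_const_bound[where B=1]) (auto simp: abs_m m_le_1)
  have integrable_mm: "\<lbrakk>g \<in> I; D \<in> sets ?R; E \<in> sets ?R\<rbrakk> \<Longrightarrow> integrable N (\<lambda>y. m D y * m E (b g y))"
    for g D E
    by (rule N.integrable_const_bound[where B=1])
      (auto simp: abs_mult abs_m intro: mult_le_one m_le_1 m_nonneg)
  have mm_nonneg: "0 \<le> (\<integral>y. m D y * m E (b g y) \<partial>N)" for g D E
    by (rule integral_nonneg_AE) (auto simp: m_nonneg)
  have m_union: "m (A \<union> B) y = m A y + m B y" if "A \<in> sets ?R" "B \<in> sets ?R" "A \<inter> B = {}" for A B y
    unfolding m_def vimage_Un by (rule Z.finite_measure_Union) (use that in \<open>auto intro: sets_Pair2\<close>)
  have add_right: "\<Delta> g D (A \<union> B) = \<Delta> g D A + \<Delta> g D B"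
    if "g \<in> I" "D \<in> sets ?R" "A \<in> sets ?R" "B \<in> sets ?R" "A \<inter> B = {}" for g D A B
  proof -
    have "measure ?R ((D \<inter> (T g -` A \<inter> space ?R)) \<union> (D \<inter> (T g -` B \<inter> space ?R)))
        = measure ?R (D \<inter> (T g -` A \<inter> space ?R)) + measure ?R (D \<inter> (T g -` B \<inter> space ?R))"
      by (rule ZN.P.finite_measure_Union) (use that T_pre[of g] in auto)
    moreover have "(D \<inter> (T g -` A \<inter> space ?R)) \<union> (D \<inter> (T g -` B \<inter> space ?R)) = D \<inter> (T g -` (A \<union> B) \<inter> space ?R)"
      by blast
    ultimately show ?thesis
      unfolding \<Delta>_def using that by (simp add: m_union distrib_left integrable_mm)
  qed
  have add_left: "\<Delta> g (A \<union> B) D = \<Delta> g A D + \<Delta> g B D"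
    if "g \<in> I" "D \<in> sets ?R" "A \<in> sets ?R" "B \<in> sets ?R" "A \<inter> B = {}" for g D A B
  proof -
    have "measure ?R ((A \<inter> (T g -` D \<inter> space ?R)) \<union> (B \<inter> (T g -` D \<inter> space ?R)))
        = measure ?R (A \<inter> (T g -` D \<inter> space ?R)) + measure ?R (B \<inter> (T g -` D \<inter> space ?R))"
      by (rule ZN.P.finite_measure_Union) (use that T_pre[of g] in auto)
    moreover have "(A \<inter> (T g -` D \<inter> space ?R)) \<union> (B \<inter> (T g -` D \<inter> space ?R)) = (A \<union> B) \<inter> (T g -` D \<inter> space ?R)"
      by blast
    ultimately show ?thesis
      unfolding \<Delta>_def using that by (simp add: m_union distrib_right integrable_mm)
  qed
  have abs_diff_le: "\<bar>x - y\<bar> \<le> c" if "0 \<le> x" "x \<le> c" "0 \<le> y" "y \<le> c" for x y c :: real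
    using that by linarith
  have bound_right: "\<bar>\<Delta> g D A\<bar> \<le> measure ?R A" if "g \<in> I" "D \<in> sets ?R" "A \<in> sets ?R" for g D A
  proof -
    have "measure ?R (D \<inter> (T g -` A \<inter> space ?R)) \<le> measure ?R (T g -` A \<inter> space ?R)"
      by (rule ZN.P.finite_measure_mono) (use that T_pre in auto)
    moreover have "(\<integral>y. m D y * m A (b g y) \<partial>N) \<le> (\<integral>y. m A (b g y) \<partial>N)"
      by (rule integral_mono) (use that integrable_mm integrable_mb prod_le in auto)
    ultimately show ?thesis
      unfolding \<Delta>_def using that by (intro abs_diff_le mm_nonneg) (simp_all add: T_measure mb_int)
  qed
  have bound_left: "\<bar>\<Delta> g A D\<bar> \<le> measure ?R A" if "g \<in> I" "D \<in> sets ?R" "A \<in> sets ?R" for g D A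
  proof -
    have "measure ?R (A \<inter> (T g -` D \<inter> space ?R)) \<le> measure ?R A"
      by (rule ZN.P.finite_measure_mono) (use that in auto)
    moreover have "(\<integral>y. m A y * m D (b g y) \<partial>N) \<le> (\<integral>y. m A y \<partial>N)"
      by (rule integral_mono) (use that integrable_mm integrable_m prod_le in auto)
    ultimately show ?thesis
      unfolding \<Delta>_def using that by (intro abs_diff_le mm_nonneg) (simp_all add: m_int)
  qed
  define \<R> where "\<R> = {A \<times> C | A C. A \<in> \<G> \<and> C \<in> sets N}"
  have \<G>_sets: "A \<in> sets Z" if "A \<in> \<G>" for A using gen(1) that by auto
  have "sets ?R = sets (sigma (space Z \<times> space N) \<R>)"
    unfolding \<R>_def
    by (rule sets_pair_eq[where Ca="{space Z}" and Cb="{space N}"])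
      (use gen sets.space_closed[of N] in \<open>auto simp: sets.sigma_sets_eq simp del: Pow_iff\<close>)
  moreover have \<R>_sub: "\<R> \<subseteq> Pow (space ?R)"
    using gen(3) by (auto simp: \<R>_def space_pair_measure dest: sets.sets_into_space)
  ultimately have \<R>_sets: "sets ?R = sigma_sets (space ?R) \<R>"
    by (simp add: space_pair_measure)
  have \<R>_stable: "Int_stable \<R>"
  proof (rule Int_stableI)
    fix P Q assume "P \<in> \<R>" "Q \<in> \<R>"
    then obtain A B C D where *: "P = A \<times> B" "Q = C \<times> D" "A \<in> \<G>" "B \<in> sets N" "C \<in> \<G>" "D \<in> sets N"
      unfolding \<R>_def by blast
    have "P \<inter> Q = (A \<inter> C) \<times> (B \<inter> D)" using * by auto
    moreover have "A \<inter> C \<in> \<G>" using gen(2) * by (auto simp: Int_stable_def)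
    ultimately show "P \<inter> Q \<in> \<R>" unfolding \<R>_def using * by blast
  qed
  have space_\<R>: "space ?R \<in> \<R>" using gen(4) by (auto simp: \<R>_def space_pair_measure)
  have \<R>_in: "D \<in> \<R> \<Longrightarrow> D \<in> sets ?R" for D by (simp add: \<R>_sets)
  have rect: "((\<lambda>g. \<Delta> g D E) \<longlongrightarrow> 0) \<Phi>" if "D \<in> \<R>" "E \<in> \<R>" for D E
  proof -
    from that obtain A B C C' where D: "D = A \<times> C" and E: "E = B \<times> C'"
      and AB: "A \<in> \<G>" "B \<in> \<G>" and C: "C \<in> sets N" "C' \<in> sets N"
      unfolding \<R>_def by blast
    note AB_sets = AB[THEN \<G>_sets]
    define n where "n g = measure N (C \<inter> (b g -` C' \<inter> space N))" for g
    have m_rect: "m (A \<times> C) y = measure Z A * indicator C y" for A C y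
      by (cases "y \<in> C") (auto simp: m_def)
    \<comment> \<open>On rectangles the deviation is the mixing error of the first factor times the
      measure \<open>n g\<close> of a set in the second. The latter is at most 1, so no convergence
      is asked of \<open>b\<close>.\<close>
    have eq: "\<Delta> g D E = (measure Z (A \<inter> (a g -` B \<inter> space Z)) - measure Z A * measure Z B) * n g"
      if g: "g \<in> I" for g
    proof -
      have pre: "a g -` B \<inter> space Z \<in> sets Z" "b g -` C' \<inter> space N \<in> sets N"
        using measurable_sets[OF a[OF g]] measurable_sets[OF b[OF g]] AB_sets C by auto
      have "D \<inter> (T g -` E \<inter> space ?R) = (A \<inter> (a g -` B \<inter> space Z)) \<times> (C \<inter> (b g -` C' \<inter> space N))"
        by (auto simp: D E T_def space_pair_measure)
      then have "measure ?R (D \<inter> (T g -` E \<inter> space ?R)) = measure Z (A \<inter> (a g -` B \<inter> space Z)) * n g"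
        using pre AB_sets C by (simp add: n_def measure_Times)
      moreover have "(\<integral>y. m D y * m E (b g y) \<partial>N) = measure Z A * measure Z B * n g"
      proof -
        have "(\<integral>y. m D y * m E (b g y) \<partial>N)
            = (\<integral>y. measure Z A * measure Z B * indicator (C \<inter> (b g -` C' \<inter> space N)) y \<partial>N)"
          by (rule Bochner_Integration.integral_cong) (auto simp: D E m_rect indicator_def)
        then show ?thesis by (simp add: n_def Int_assoc)
      qed
      ultimately show ?thesis by (simp add: \<Delta>_def algebra_simps)
    qed
    have "((\<lambda>g. measure Z (A \<inter> (a g -` B \<inter> space Z)) - measure Z A * measure Z B) \<longlongrightarrow> 0) \<Phi>"
      using tendsto_diff[OF mix[OF AB] tendsto_const[of "measure Z A * measure Z B"]] by simp
    moreover have "\<forall>\<^sub>F g in \<Phi>. norm (\<Delta> g D E) \<le>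
        norm (measure Z (A \<inter> (a g -` B \<inter> space Z)) - measure Z A * measure Z B) * 1"
      using index
    proof eventually_elim
      fix g assume "g \<in> I"
      have "0 \<le> n g" "n g \<le> 1" by (simp_all add: n_def)
      then show "norm (\<Delta> g D E) \<le>
          norm (measure Z (A \<inter> (a g -` B \<inter> space Z)) - measure Z A * measure Z B) * 1"
        unfolding eq[OF \<open>g \<in> I\<close>] norm_mult by (intro mult_left_mono) auto
    qed
    ultimately show ?thesis by (rule tendsto_0_le)
  qed
  note Dynkin = tendsto_zero_Int_stable_generator[OF ZN.P.finite_measure_axioms \<R>_sets \<R>_stable \<R>_sub index]
  \<comment> \<open>The Dynkin argument runs in the second set while the first is a rectangle, and
    afterwards in the first set while the second is arbitrary.\<close>
  have half: "((\<lambda>g. \<Delta> g D E) \<longlongrightarrow> 0) \<Phi>" if "D \<in> \<R>" "E \<in> sets ?R" for D E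
    by (rule Dynkin[of "\<lambda>g. \<Delta> g D"])
      (fact add_right[OF _ \<R>_in[OF that(1)]] bound_right[OF _ \<R>_in[OF that(1)]]
        rect[OF that(1)] rect[OF that(1) space_\<R>] that)+
  have all: "((\<lambda>g. \<Delta> g D E) \<longlongrightarrow> 0) \<Phi>" if "D \<in> sets ?R" "E \<in> sets ?R" for D E
    by (rule Dynkin[of "\<lambda>g D. \<Delta> g D E"])
      (fact add_left[OF _ that(2)] bound_left[OF _ that(2)]
        half[OF _ that(2)] half[OF space_\<R> that(2)] that)+
  have sq: "integrable N (\<lambda>y. m E y * m E y)"
    by (rule N.integrable_const_bound[where B=1])
      (use E in \<open>auto simp: abs_mult abs_m intro: mult_le_one m_le_1 m_nonneg\<close>)
  \<comment> \<open>Invariance of \<open>E\<close> turns the joint measure into that of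
    \<open>E\<close>. The subtracted integral is at most that of the square of \<open>m E\<close>,
    by the inequality of arithmetic and geometric means and because \<open>b g\<close> preserves
    \<open>N\<close>. The resulting lower bound is free of \<open>g\<close>.\<close>
  have lower: "measure ?R E - (\<integral>y. m E y * m E y \<partial>N) \<le> \<Delta> g E E" if g: "g \<in> I" for g
  proof -
    have "AE p in ?R. p \<in> E \<inter> (T g -` E \<inter> space ?R) \<longleftrightarrow> p \<in> E"
      using inv[OF g] AE_space[of ?R] by eventually_elim (auto simp: T_def)
    then have "measure ?R (E \<inter> (T g -` E \<inter> space ?R)) = measure ?R E"
      by (intro measure_eq_AE) (use E T_pre[OF g E] in auto)
    moreover have "(\<integral>y. m E y * m E (b g y) \<partial>N) \<le>
        (\<integral>y. (1/2) * (m E y * m E y) + (1/2) * (m E (b g y) * m E (b g y)) \<partial>N)"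
    proof (rule integral_mono)
      show "integrable N (\<lambda>y. m E y * m E (b g y))" by (rule integrable_mm[OF g E E])
      have "integrable N (\<lambda>y. m E (b g y) * m E (b g y))"
        by (rule N.integrable_const_bound[where B=1])
          (use E g in \<open>auto simp: abs_mult abs_m intro: mult_le_one m_le_1 m_nonneg\<close>)
      then show "integrable N (\<lambda>y. (1/2) * (m E y * m E y) + (1/2) * (m E (b g y) * m E (b g y)))"
        using sq by simp
      show "m E y * m E (b g y) \<le> (1/2) * (m E y * m E y) + (1/2) * (m E (b g y) * m E (b g y))" for y
        using zero_le_square[of "m E y - m E (b g y)"] by (simp add: algebra_simps)
    qed
    moreover have "(\<integral>y. m E (b g y) * m E (b g y) \<partial>N) = (\<integral>y. m E y * m E y \<partial>N)"
      using integral_distr[OF b[OF g], of "\<lambda>y. m E y * m E y"] E b_mp[OF g] by simp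
    moreover have "integrable N (\<lambda>y. m E (b g y) * m E (b g y))"
      by (rule N.integrable_const_bound[where B=1])
        (use E g in \<open>auto simp: abs_mult abs_m intro: mult_le_one m_le_1 m_nonneg\<close>)
    ultimately show ?thesis unfolding \<Delta>_def using sq by simp
  qed
  have "measure ?R E - (\<integral>y. m E y * m E y \<partial>N) \<le> 0"
    by (rule tendsto_lowerbound[OF all[OF E E] _ \<Phi>]) (use index lower in \<open>auto elim: eventually_mono\<close>)
  \<comment> \<open>Since \<open>m E\<close> lies between 0 and 1, the integrand is nonnegative; a
    nonpositive integral forces it to vanish almost everywhere, that is, \<open>m E\<close> is 0 or
    1.\<close>
  then have "(\<integral>y. m E y - m E y * m E y \<partial>N) \<le> 0"
    using sq integrable_m[OF E] m_int[OF E] by simp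
  moreover have nonneg: "0 \<le> m E y - m E y * m E y" for y using prod_le[of E y E y] by simp
  ultimately have "(\<integral>y. m E y - m E y * m E y \<partial>N) = 0"
    by (intro antisym integral_nonneg_AE) auto
  then have "AE y in N. m E y - m E y * m E y = 0"
    using integral_nonneg_eq_0_iff_AE[of N "\<lambda>y. m E y - m E y * m E y"] sq integrable_m[OF E] nonneg by simp
  then show ?thesis
    by eventually_elim (auto simp: m_def[symmetric] algebra_simps)
qed

end

text \<open>The sets \<open>S (F, e)\<close> of group elements good for \<open>F\<close> up to
  \<open>e\<close> are nonempty by weak mixing and directed downwards, since
  \<open>S (F \<union> F', min e e')\<close> lies in both \<open>S (F, e)\<close> and
  \<open>S (F', e')\<close>. They generate a proper filter along which the correlations of all pairs
  of measurable sets converge simultaneously, without the choice of a countable dense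
  family.\<close>

lemma weakly_mixing_filter:
  assumes "weakly_mixing G M \<sigma>"
  obtains \<Phi> where "\<Phi> \<noteq> bot" "\<forall>\<^sub>F g in \<Phi>. g \<in> carrier G"
    "\<And>A B. \<lbrakk>A \<in> sets M; B \<in> sets M\<rbrakk> \<Longrightarrow>
      ((\<lambda>g. measure M (A \<inter> \<sigma> g ` B)) \<longlongrightarrow> measure M A * measure M B) \<Phi>"
proof -
  define S where "S = (\<lambda>(F, e). {g \<in> carrier G. \<forall>A\<in>F. \<forall>B\<in>F.
    \<bar>measure M (A \<inter> \<sigma> g ` B) - measure M A * measure M B\<bar> < (e::real)})"
  define J where "J = {(F, e). finite F \<and> F \<subseteq> sets M \<and> (0::real) < e}"
  define \<Phi> where "\<Phi> = (INF j\<in>J. principal (S j))"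
  have "({}, 1) \<in> J" by (simp add: J_def)
  then have "J \<noteq> {}" by blast
  moreover have "\<exists>j\<in>J. principal (S j) \<le> inf (principal (S i)) (principal (S i'))"
    if ii: "i \<in> J" "i' \<in> J" for i i'
  proof -
    obtain F e F' e' where i: "i = (F, e)" "i' = (F', e')" by fastforce
    have "(F \<union> F', min e e') \<in> J" using ii by (auto simp: J_def i)
    moreover have "S (F \<union> F', min e e') \<subseteq> S i \<inter> S i'" by (auto simp: S_def i)
    ultimately show ?thesis by (intro bexI[of _ "(F \<union> F', min e e')"]) auto
  qed
  ultimately have ev: "eventually P \<Phi> \<longleftrightarrow> (\<exists>j\<in>J. eventually P (principal (S j)))" for P
    unfolding \<Phi>_def by (rule eventually_INF_base)
  have "S j \<noteq> {}" if "j \<in> J" for j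
  proof -
    obtain F e where j: "j = (F, e)" by fastforce
    then have "finite F \<and> F \<subseteq> sets M \<and> 0 < e" using that by (simp add: J_def)
    with assms show ?thesis unfolding weakly_mixing_def S_def j by blast
  qed
  then have "\<Phi> \<noteq> bot"
    unfolding trivial_limit_def ev eventually_principal by blast
  moreover have "\<forall>\<^sub>F g in \<Phi>. g \<in> carrier G"
    unfolding ev eventually_principal using \<open>({}, 1) \<in> J\<close> by (intro bexI[of _ "({}, 1)"]) (auto simp: S_def)
  moreover have "((\<lambda>g. measure M (A \<inter> \<sigma> g ` B)) \<longlongrightarrow> measure M A * measure M B) \<Phi>"
    if "A \<in> sets M" "B \<in> sets M" for A B
  proof (rule tendstoI)
    fix e :: real assume "0 < e"
    then show "\<forall>\<^sub>F g in \<Phi>. dist (measure M (A \<inter> \<sigma> g ` B)) (measure M A * measure M B) < e"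
      unfolding ev eventually_principal using that
      by (intro bexI[of _ "({A, B}, e)"]) (auto simp: S_def J_def dist_real_def)
  qed
  ultimately show ?thesis by (rule that)
qed

section \<open>Polish groups with small invariant neighbourhoods\<close>

lemma polish_topology_second_countable:
  assumes "polish_topology T"
  shows "second_countable T"
proof -
  obtain M d where M: "Metric_space M d" and T: "T = Metric_space.mtopology M d"
    using assms unfolding polish_topology_def completely_metrizable_space_def by blast
  interpret Metric_space M d by fact
  obtain C where C: "countable C" "C \<subseteq> M" "mtopology closure_of C = M"
    using assms unfolding polish_topology_def separable_space_def T by auto
  define \<B> where "\<B> = (\<lambda>(c, n). mball c (1 / Suc n)) ` (C \<times> UNIV)"
  have "countable \<B>" using C by (simp add: \<B>_def)
  moreover have "\<forall>B\<in>\<B>. openin mtopology B" by (auto simp: \<B>_def)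
  moreover have "\<exists>B\<in>\<B>. x \<in> B \<and> B \<subseteq> U" if U: "openin mtopology U" "x \<in> U" for U x
  proof -
    obtain r where r: "r > 0" "mball x r \<subseteq> U" using U unfolding openin_mtopology by blast
    have x: "x \<in> M" using U unfolding openin_mtopology by blast
    obtain n where n: "1 / Suc n < r / 2"
      using nat_approx_posE[of "r / 2"] r by auto
    have "\<forall>r>0. \<exists>c\<in>C. c \<in> mball x r" using C(3) x unfolding metric_closure_of by blast
    moreover have "0 < 1 / real (Suc n)" by simp
    ultimately obtain c where c: "c \<in> C" "c \<in> mball x (1 / Suc n)" by blast
    have "x \<in> mball c (1 / Suc n)" using c x C by (simp add: commute)
    moreover have "mball c (1 / Suc n) \<subseteq> mball x r"
      using n c x C triangle[of x c] by (intro mball_subset) (auto simp: commute)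
    ultimately show ?thesis
      using r c by (intro bexI[of _ "mball c (1 / Suc n)"]) (auto simp: \<B>_def)
  qed
  ultimately show ?thesis unfolding second_countable_def T by blast
qed

lemma second_countable_base:
  assumes "second_countable T"
  obtains \<B> where "countable \<B>" "\<And>B. B \<in> \<B> \<Longrightarrow> openin T B"
    "\<And>Q x. \<lbrakk>openin T Q; x \<in> Q\<rbrakk> \<Longrightarrow> \<exists>B\<in>\<B>. x \<in> B \<and> B \<subseteq> Q"
  using assms unfolding second_countable_def by auto

lemma openin_prod_topology_box:
  assumes P: "openin (prod_topology S T) P" and xy: "(x, y) \<in> P"
  obtains A B where "openin S A" "openin T B" "x \<in> A" "y \<in> B" "A \<times> B \<subseteq> P"
proof -
  from P have "\<forall>x y. (x, y) \<in> P \<longrightarrow>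
      (\<exists>U V. openin S U \<and> openin T V \<and> x \<in> U \<and> y \<in> V \<and> U \<times> V \<subseteq> P)"
    by (simp only: openin_prod_topology_alt)
  with xy have "\<exists>U V. openin S U \<and> openin T V \<and> x \<in> U \<and> y \<in> V \<and> U \<times> V \<subseteq> P" by simp
  then show ?thesis by (elim exE conjE) (rule that)
qed

section \<open>Borel measurability of maps into a topological space\<close>

lemma space_borel_of [simp]: "space (borel_of T) = topspace T"
  by (simp add: borel_of_def space_measure_of_conv)

lemma sets_borel_of: "sets (borel_of T) = sigma_sets (topspace T) {U. openin T U}"
  unfolding borel_of_def by (rule sets_measure_of) (auto dest: openin_subset)

lemma borel_of_open [intro]: "openin T U \<Longrightarrow> U \<in> sets (borel_of T)"
  by (auto simp: sets_borel_of)

lemma borel_of_closed: "closedin T C \<Longrightarrow> C \<in> sets (borel_of T)"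
proof -
  assume C: "closedin T C"
  then have "space (borel_of T) - (topspace T - C) \<in> sets (borel_of T)"
    by (intro sets.compl_sets borel_of_open) (simp add: closedin_def)
  then show ?thesis using C by (simp add: closedin_def double_diff)
qed

lemma measurable_borel_ofI:
  assumes "f \<in> space R \<rightarrow> topspace T" and "\<And>U. openin T U \<Longrightarrow> f -` U \<inter> space R \<in> sets R"
  shows "f \<in> measurable R (borel_of T)"
  by (rule measurable_sigma_sets[OF sets_borel_of]) (use assms in \<open>auto dest: openin_subset\<close>)

lemma measurable_borel_of_continuous:
  assumes f: "f \<in> measurable R (borel_of S)" and h: "continuous_map S T h"
  shows "(\<lambda>t. h (f t)) \<in> measurable R (borel_of T)"
proof (rule measurable_borel_ofI)
  have fS: "f t \<in> topspace S" if "t \<in> space R" for t using measurable_space[OF f that] by simp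
  then show "(\<lambda>t. h (f t)) \<in> space R \<rightarrow> topspace T"
    using continuous_map_image_subset_topspace[OF h] by auto
  fix U assume "openin T U"
  then have "{x \<in> topspace S. h x \<in> U} \<in> sets (borel_of S)"
    by (intro borel_of_open openin_continuous_map_preimage[OF h])
  then have "f -` {x \<in> topspace S. h x \<in> U} \<inter> space R \<in> sets R" by (rule measurable_sets[OF f])
  moreover have "f -` {x \<in> topspace S. h x \<in> U} \<inter> space R = (\<lambda>t. h (f t)) -` U \<inter> space R"
    using fS by auto
  ultimately show "(\<lambda>t. h (f t)) -` U \<inter> space R \<in> sets R" by simp
qed

text \<open>Second countability writes an open subset of the product as a countable union of open
  boxes, whose preimages under the pair of maps are measurable. This makes products of measurable
  group-valued maps measurable.\<close>

lemma measurable_borel_of_continuous2: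
  assumes T: "second_countable T"
    and f: "f \<in> measurable R (borel_of T)" and g: "g \<in> measurable R (borel_of T)"
    and h: "continuous_map (prod_topology T T) S (\<lambda>(x, y). h x y)"
  shows "(\<lambda>t. h (f t) (g t)) \<in> measurable R (borel_of S)"
proof (rule measurable_borel_ofI)
  have fT: "f t \<in> topspace T" and gT: "g t \<in> topspace T" if "t \<in> space R" for t
    using measurable_space[OF f that] measurable_space[OF g that] by auto
  then show "(\<lambda>t. h (f t) (g t)) \<in> space R \<rightarrow> topspace S"
    using continuous_map_image_subset_topspace[OF h] by auto
  fix U assume U: "openin S U"
  obtain \<B> where \<B>: "countable \<B>" "\<And>B. B \<in> \<B> \<Longrightarrow> openin T B"
    and base: "\<And>Q x. \<lbrakk>openin T Q; x \<in> Q\<rbrakk> \<Longrightarrow> \<exists>B\<in>\<B>. x \<in> B \<and> B \<subseteq> Q"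
    using second_countable_base[OF T] by metis
  define P where "P = {p \<in> topspace (prod_topology T T). (\<lambda>(x, y). h x y) p \<in> U}"
  have "openin (prod_topology T T) P" unfolding P_def by (rule openin_continuous_map_preimage[OF h U])
  have P: "\<exists>B\<in>\<B>. \<exists>C\<in>\<B>. x \<in> B \<and> y \<in> C \<and> B \<times> C \<subseteq> P" if xy: "(x, y) \<in> P" for x y
  proof -
    obtain B' C' where
      BC: "openin T B'" "openin T C'" "x \<in> B'" "y \<in> C'" "B' \<times> C' \<subseteq> P"
      by (rule openin_prod_topology_box[OF \<open>openin (prod_topology T T) P\<close> xy])
    obtain B where B: "B \<in> \<B>" "x \<in> B" "B \<subseteq> B'" using base[OF BC(1,3)] by blast
    obtain C where C: "C \<in> \<B>" "y \<in> C" "C \<subseteq> C'" using base[OF BC(2,4)] by blast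
    have "B \<times> C \<subseteq> P" by (rule order_trans[OF Sigma_mono BC(5)]) (use B C in auto)
    then show ?thesis using B(1,2) C(1,2) by (intro bexI conjI)
  qed
  define J where "J = {(B, C) \<in> \<B> \<times> \<B>. B \<times> C \<subseteq> P}"
  have "countable J" by (rule countable_subset[of _ "\<B> \<times> \<B>"]) (auto simp: J_def \<B>)
  have "(\<lambda>t. h (f t) (g t)) -` U \<inter> space R = (\<Union>(B, C)\<in>J. (f -` B \<inter> space R) \<inter> (g -` C \<inter> space R))"
    (is "?L = ?R")
  proof
    show "?L \<subseteq> ?R"
    proof
      fix t assume t: "t \<in> ?L"
      then have "(f t, g t) \<in> P" using fT gT by (auto simp: P_def)
      from P[OF this] show "t \<in> ?R" using t by (fastforce simp: J_def)
    qed
    show "?R \<subseteq> ?L" by (auto simp: J_def P_def)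
  qed
  moreover have "?R \<in> sets R"
    using \<open>countable J\<close>
    by (rule sets.countable_UN'') (auto simp: J_def intro!: sets.Int measurable_sets[OF f] measurable_sets[OF g] borel_of_open \<B>)
  ultimately show "(\<lambda>t. h (f t) (g t)) -` U \<inter> space R \<in> sets R" by simp
qed

text \<open>Open sets of the subspace are traces of open sets of \<open>T\<close>, so measurability
  of a \<open>V\<close>-valued map can be checked in the large group.\<close>

lemma measurable_borel_of_subtopology:
  "f \<in> measurable R (borel_of (subtopology T V)) \<longleftrightarrow>
     f \<in> measurable R (borel_of T) \<and> f \<in> space R \<rightarrow> V"
proof
  assume f: "f \<in> measurable R (borel_of (subtopology T V))"
  then show "f \<in> measurable R (borel_of T) \<and> f \<in> space R \<rightarrow> V"
    using measurable_borel_of_continuous[OF f continuous_map_id_subt] measurable_space[OF f] by auto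
next
  assume f: "f \<in> measurable R (borel_of T) \<and> f \<in> space R \<rightarrow> V"
  show "f \<in> measurable R (borel_of (subtopology T V))"
  proof (rule measurable_borel_ofI)
    show "f \<in> space R \<rightarrow> topspace (subtopology T V)"
      using f measurable_space[of f R "borel_of T"] by auto
    fix U assume "openin (subtopology T V) U"
    then obtain S where "openin T S" "U = S \<inter> V" by (auto simp: openin_subtopology)
    moreover have "f -` (S \<inter> V) \<inter> space R = f -` S \<inter> space R" using f by auto
    ultimately show "f -` U \<inter> space R \<in> sets R"
      using measurable_sets[of f R "borel_of T" S] f by auto
  qed
qed

section \<open>Topological groups and neighbourhoods of a closed subgroup\<close>

lemma set_mult_memI: "\<lbrakk>v \<in> V; x \<in> U\<rbrakk> \<Longrightarrow> v \<otimes>\<^bsub>W\<^esub> x \<in> V <#>\<^bsub>W\<^esub> U"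
  by (auto simp: set_mult_def)

lemma set_mult_memE:
  assumes "p \<in> V <#>\<^bsub>W\<^esub> U"
  obtains v x where "v \<in> V" "x \<in> U" "p = v \<otimes>\<^bsub>W\<^esub> x"
  using assms by (auto simp: set_mult_def)

locale topological_group = group W for W :: "'w monoid" (structure) +
  fixes T :: "'w topology"
  assumes topspace_carrier: "topspace T = carrier W"
    and continuous_mult: "continuous_map (prod_topology T T) T (\<lambda>(x, y). x \<otimes> y)"
    and continuous_inv: "continuous_map T T (\<lambda>x. inv x)"
begin

lemma continuous_mult':
  "\<lbrakk>continuous_map X T f; continuous_map X T g\<rbrakk> \<Longrightarrow> continuous_map X T (\<lambda>x. f x \<otimes> g x)"
  using continuous_map_compose[OF continuous_map_pairedI continuous_mult] by (simp add: comp_def)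

lemma continuous_inv': "continuous_map X T f \<Longrightarrow> continuous_map X T (\<lambda>x. inv (f x))"
  using continuous_map_compose[OF _ continuous_inv] by (simp add: comp_def)

lemma continuous_quotient: "continuous_map (prod_topology T T) T (\<lambda>(x, y). x \<otimes> inv y)"
  using continuous_mult'[OF continuous_map_fst continuous_inv'[OF continuous_map_snd]]
  by (simp add: case_prod_unfold)

text \<open>The product is a union of left translates of \<open>U\<close>, each of them the preimage
  of \<open>U\<close> under a continuous translation.\<close>

lemma openin_subgroup_product:
  assumes "openin T U" "V \<subseteq> carrier W"
  shows "openin T (V <#> U)"
proof -
  have "openin T ((\<lambda>x. v \<otimes> x) ` U)" if "v \<in> V" for v
  proof -
    have v: "v \<in> carrier W" using that assms by blast
    have U: "U \<subseteq> carrier W" using assms(1) topspace_carrier openin_subset by blast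
    have "(\<lambda>x. v \<otimes> x) ` U = {x \<in> topspace T. inv v \<otimes> x \<in> U}"
    proof (rule equalityI; rule subsetI)
      fix x assume "x \<in> {x \<in> topspace T. inv v \<otimes> x \<in> U}"
      then have "inv v \<otimes> x \<in> U" "x = v \<otimes> (inv v \<otimes> x)"
        using v by (simp_all add: topspace_carrier m_assoc[symmetric])
      then show "x \<in> (\<lambda>x. v \<otimes> x) ` U" by blast
    next
      fix x assume "x \<in> (\<lambda>x. v \<otimes> x) ` U"
      then obtain z where z: "z \<in> U" "x = v \<otimes> z" by blast
      then have "z \<in> carrier W" using U by blast
      then have "inv v \<otimes> x = z" "x \<in> carrier W" using v z by (simp_all add: m_assoc[symmetric])
      then show "x \<in> {x \<in> topspace T. inv v \<otimes> x \<in> U}" using z by (simp add: topspace_carrier)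
    qed
    moreover have "continuous_map T T (\<lambda>x. inv v \<otimes> x)"
      by (intro continuous_mult') (simp_all add: topspace_carrier v)
    ultimately show ?thesis using openin_continuous_map_preimage assms(1) by fastforce
  qed
  moreover have "V <#> U = (\<Union>v\<in>V. (\<lambda>x. v \<otimes> x) ` U)" by (auto simp: set_mult_def)
  ultimately show ?thesis by auto
qed

text \<open>For \<open>U\<close> invariant under conjugation,
  \<open>a v x b = (a v b) (b^-1 x b)\<close> shows that \<open>V <#> U\<close> absorbs
  \<open>V\<close> on both sides. One such \<open>U\<close> inside each member at
  \<open>\<one>\<close> of a countable base keeps the family countable, and closedness of
  \<open>V\<close> separates it from the points outside.\<close>

lemma biinvariant_nhds:
  assumes T: "second_countable T" and small: "small_invariant_nhds W T"
    and V: "subgroup V W" and closed: "closedin T V"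
  obtains \<O> where "countable \<O>"
    and "\<And>Q. Q \<in> \<O> \<Longrightarrow> openin T Q \<and> \<one> \<in> Q"
    and "\<And>Q a b p. \<lbrakk>Q \<in> \<O>; a \<in> V; b \<in> V; p \<in> carrier W\<rbrakk> \<Longrightarrow> a \<otimes> p \<otimes> b \<in> Q \<longleftrightarrow> p \<in> Q"
    and "\<And>p. \<lbrakk>p \<in> carrier W; p \<notin> V\<rbrakk> \<Longrightarrow> \<exists>Q\<in>\<O>. p \<notin> Q"
proof -
  obtain \<B> where \<B>: "countable \<B>" "\<And>B. B \<in> \<B> \<Longrightarrow> openin T B"
    and base: "\<And>Q x. \<lbrakk>openin T Q; x \<in> Q\<rbrakk> \<Longrightarrow> \<exists>B\<in>\<B>. x \<in> B \<and> B \<subseteq> Q"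
    using second_countable_base[OF T] by metis
  interpret V: subgroup V W by fact
  have "\<forall>B\<in>{B \<in> \<B>. \<one> \<in> B}. \<exists>U. openin T U \<and> \<one> \<in> U \<and> U \<subseteq> B \<and>
      (\<forall>a\<in>carrier W. \<forall>x\<in>U. a \<otimes> x \<otimes> inv a \<in> U)"
    using small \<B>(2) unfolding small_invariant_nhds_def by blast
  then obtain U where U: "\<And>B. \<lbrakk>B \<in> \<B>; \<one> \<in> B\<rbrakk> \<Longrightarrow> openin T (U B) \<and> \<one> \<in> U B \<and> U B \<subseteq> B"
    and conj: "\<And>B a x. \<lbrakk>B \<in> \<B>; \<one> \<in> B; a \<in> carrier W; x \<in> U B\<rbrakk> \<Longrightarrow> a \<otimes> x \<otimes> inv a \<in> U B"
    by (metis (mono_tags, lifting) mem_Collect_eq)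
  have U_carrier: "x \<in> carrier W" if "B \<in> \<B>" "\<one> \<in> B" "x \<in> U B" for B x
    using U[OF that(1,2)] that(3) openin_subset topspace_carrier by blast
  define \<O> where "\<O> = (\<lambda>B. V <#> U B) ` {B \<in> \<B>. \<one> \<in> B}"
  show ?thesis
  proof (rule that[of \<O>])
    show "countable \<O>" using \<B>(1) by (auto simp: \<O>_def)
    show "openin T Q \<and> \<one> \<in> Q" if "Q \<in> \<O>" for Q
    proof -
      obtain B where B: "B \<in> \<B>" "\<one> \<in> B" "Q = V <#> U B" using \<open>Q \<in> \<O>\<close> by (auto simp: \<O>_def)
      have "\<one> \<otimes> \<one> \<in> V <#> U B" by (rule set_mult_memI) (use U[OF B(1,2)] in auto)
      then show ?thesis using U[OF B(1,2)] openin_subgroup_product V.subset by (simp add: B)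
    qed
    have mult: "a \<otimes> p \<otimes> b \<in> Q" if "Q \<in> \<O>" "a \<in> V" "b \<in> V" "p \<in> Q" for Q a b p
    proof -
      obtain B where B: "B \<in> \<B>" "\<one> \<in> B" "Q = V <#> U B" using \<open>Q \<in> \<O>\<close> by (auto simp: \<O>_def)
      obtain v x where p: "v \<in> V" "x \<in> U B" "p = v \<otimes> x"
        using \<open>p \<in> Q\<close> unfolding B by (rule set_mult_memE)
      have x: "x \<in> carrier W" using U_carrier B p by blast
      have carr: "a \<in> carrier W" "b \<in> carrier W" "v \<in> carrier W" using that p by auto
      have "inv b \<otimes> x \<otimes> inv (inv b) \<in> U B" by (rule conj) (use B p carr in auto)
      moreover have "a \<otimes> p \<otimes> b = (a \<otimes> v \<otimes> b) \<otimes> (inv b \<otimes> x \<otimes> inv (inv b))"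
      proof -
        have "b \<otimes> (inv b \<otimes> (x \<otimes> b)) = x \<otimes> b"
          using x carr by (simp add: m_assoc[symmetric])
        then show ?thesis using x carr by (simp add: p m_assoc)
      qed
      moreover have "a \<otimes> v \<otimes> b \<in> V" using that p by simp
      ultimately show ?thesis unfolding B by (simp only: set_mult_memI)
    qed
    show "a \<otimes> p \<otimes> b \<in> Q \<longleftrightarrow> p \<in> Q" if "Q \<in> \<O>" "a \<in> V" "b \<in> V" "p \<in> carrier W" for Q a b p
    proof
      assume "a \<otimes> p \<otimes> b \<in> Q"
      with mult[OF that(1) V.m_inv_closed[OF that(2)] V.m_inv_closed[OF that(3)]]
      have "inv a \<otimes> (a \<otimes> p \<otimes> b) \<otimes> inv b \<in> Q" by blast
      moreover have "inv a \<otimes> (a \<otimes> p \<otimes> b) \<otimes> inv b = p"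
      proof -
        have "a \<in> carrier W" "b \<in> carrier W" using that by auto
        moreover from this have "inv a \<otimes> (a \<otimes> p) = p" using that(4) by (simp add: m_assoc[symmetric])
        ultimately show ?thesis using that(4) by (simp add: m_assoc)
      qed
      ultimately show "p \<in> Q" by simp
    qed (use that mult in blast)
    show "\<exists>Q\<in>\<O>. p \<notin> Q" if p: "p \<in> carrier W" "p \<notin> V" for p
    proof -
      \<comment> \<open>Chosen so that \<open>p = v \<otimes> x\<close> with \<open>x\<close> in
        \<open>Q\<close> would put \<open>p \<otimes> inv x = v\<close> outside
        \<open>V\<close>.\<close>
      define Q where "Q = {x \<in> topspace T. p \<otimes> inv x \<in> topspace T - V}"
      have "continuous_map T T (\<lambda>x. p \<otimes> inv x)"
        by (intro continuous_mult' continuous_inv) (simp add: topspace_carrier p)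
      then have "openin T Q" unfolding Q_def
        by (rule openin_continuous_map_preimage) (use closed in auto)
      moreover have "\<one> \<in> Q" using p by (simp add: Q_def topspace_carrier)
      ultimately obtain B where B: "B \<in> \<B>" "\<one> \<in> B" "B \<subseteq> Q" using base by blast
      have "p \<notin> V <#> U B"
      proof
        assume "p \<in> V <#> U B"
        then obtain v x where vx: "v \<in> V" "x \<in> U B" "p = v \<otimes> x" by (rule set_mult_memE)
        then have "x \<in> Q" "x \<in> carrier W" using U[OF B(1,2)] B(3) U_carrier[OF B(1,2)] by auto
        then have "p \<otimes> inv x \<notin> V" "p \<otimes> inv x = v" using vx by (auto simp: Q_def m_assoc)
        then show False using vx by simp
      qed
      then show ?thesis using B by (auto simp: \<O>_def)
    qed
  qed
qed

text \<open>The map \<open>x \<otimes> inv y\<close> is continuous with value \<open>\<one>\<close>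
  at \<open>(a, a)\<close>, so a base element contained in both sides of a small box around
  \<open>(a, a)\<close> qualifies. As the cover is countable, any probability distribution on the
  group charges one of its pieces.\<close>

lemma countable_small_cover:
  assumes T: "second_countable T" and Q: "openin T Q" "\<one> \<in> Q"
  obtains \<C> where "countable \<C>" "\<And>C. C \<in> \<C> \<Longrightarrow> openin T C" "\<Union>\<C> = carrier W"
    "\<And>C x y. \<lbrakk>C \<in> \<C>; x \<in> C; y \<in> C\<rbrakk> \<Longrightarrow> x \<otimes> inv y \<in> Q"
proof -
  obtain \<B> where \<B>: "countable \<B>" "\<And>B. B \<in> \<B> \<Longrightarrow> openin T B"
    and base: "\<And>Q x. \<lbrakk>openin T Q; x \<in> Q\<rbrakk> \<Longrightarrow> \<exists>B\<in>\<B>. x \<in> B \<and> B \<subseteq> Q"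
    using second_countable_base[OF T] by metis
  define \<C> where "\<C> = {B \<in> \<B>. \<forall>x\<in>B. \<forall>y\<in>B. x \<otimes> inv y \<in> Q}"
  define P where "P = {p \<in> topspace (prod_topology T T). (\<lambda>(x, y). x \<otimes> inv y) p \<in> Q}"
  have P: "openin (prod_topology T T) P"
    unfolding P_def by (rule openin_continuous_map_preimage[OF continuous_quotient Q(1)])
  have "\<exists>C\<in>\<C>. a \<in> C" if a: "a \<in> carrier W" for a
  proof -
    have aa: "(a, a) \<in> P" using a Q by (simp add: P_def topspace_carrier)
    obtain A B where AB: "openin T A" "openin T B" "a \<in> A" "a \<in> B" "A \<times> B \<subseteq> P"
      by (rule openin_prod_topology_box[OF P aa])
    then obtain C where C: "C \<in> \<B>" "a \<in> C" "C \<subseteq> A \<inter> B"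
      using base[of "A \<inter> B" a] by auto
    have "x \<otimes> inv y \<in> Q" if "x \<in> C" "y \<in> C" for x y
    proof -
      have "(x, y) \<in> A \<times> B" using that C(3) by auto
      then have "(x, y) \<in> P" using AB(5) by (rule subsetD[rotated])
      then show ?thesis by (simp add: P_def)
    qed
    then have "C \<in> \<C>" using C(1) by (simp add: \<C>_def)
    then show ?thesis using C by blast
  qed
  moreover have "C \<subseteq> carrier W" if "C \<in> \<C>" for C
    using that \<B>(2) openin_subset topspace_carrier unfolding \<C>_def by blast
  ultimately have "\<Union>\<C> = carrier W" by blast
  moreover have "countable \<C>" unfolding \<C>_def using \<B>(1) by (rule countable_subset[rotated]) blast
  ultimately show ?thesis by (intro that) (auto simp: \<C>_def \<B>)
qed

end

section \<open>Rigidity of maps into coset spaces\<close>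

context
  fixes G :: "'g monoid" and M :: "'x measure" and \<sigma> :: "'g \<Rightarrow> 'x \<Rightarrow> 'x"
  assumes G: "group G" and act: "mp_action G M \<sigma>"
begin

interpretation G: group G by (rule G)
interpretation act: group_action G "space M" \<sigma>
  using act by (simp add: mp_action_def)

lemma mp_action_measurable: "g \<in> carrier G \<Longrightarrow> \<sigma> (inv\<^bsub>G\<^esub> g) \<in> measurable M M"
  and mp_action_distr: "g \<in> carrier G \<Longrightarrow> distr M M (\<sigma> (inv\<^bsub>G\<^esub> g)) = M"
  using act unfolding mp_action_def by auto

lemma mp_action_inv_comp:
  assumes "g \<in> carrier G" "h \<in> carrier G" "x \<in> space M"
  shows "\<sigma> (inv\<^bsub>G\<^esub> h) (\<sigma> (inv\<^bsub>G\<^esub> g) x) = \<sigma> (inv\<^bsub>G\<^esub> (g \<otimes>\<^bsub>G\<^esub> h)) x"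
  using act.composition_rule[of x "inv\<^bsub>G\<^esub> h" "inv\<^bsub>G\<^esub> g"] assms by (simp add: G.inv_mult_group)

text \<open>Weak mixing speaks of images under \<open>\<sigma> g\<close>, whereas the cocycle
  relations and the fibre lemma work with preimages under the action of the inverse.\<close>

lemma mp_action_image:
  assumes g: "g \<in> carrier G" and B: "B \<subseteq> space M"
  shows "\<sigma> g ` B = \<sigma> (inv\<^bsub>G\<^esub> g) -` B \<inter> space M"
proof (rule equalityI; rule subsetI)
  fix x assume "x \<in> \<sigma> g ` B"
  then obtain z where z: "z \<in> B" "\<sigma> g z = x" by blast
  then show "x \<in> \<sigma> (inv\<^bsub>G\<^esub> g) -` B \<inter> space M"
    using act.orbit_sym_aux[OF g, of z x] act.element_image[OF g, of z x] B by auto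
next
  fix x assume x: "x \<in> \<sigma> (inv\<^bsub>G\<^esub> g) -` B \<inter> space M"
  then have "\<sigma> g (\<sigma> (inv\<^bsub>G\<^esub> g) x) = x"
    using act.orbit_sym_aux[of "inv\<^bsub>G\<^esub> g" x] g by simp
  then show "x \<in> \<sigma> g ` B" using x by (metis IntD1 imageI vimageD)
qed

end

section \<open>Almost everywhere statements on product spaces\<close>

lemma distr_pair_snd:
  assumes "prob_space M" "prob_space N"
  shows "distr (M \<Otimes>\<^sub>M N) N snd = N"
proof -
  interpret M: prob_space M by fact
  interpret N: prob_space N by fact
  show ?thesis
  proof (intro measure_eqI)
    fix A assume A: "A \<in> sets (distr (M \<Otimes>\<^sub>M N) N snd)"
    then have "emeasure (distr (M \<Otimes>\<^sub>M N) N snd) A = emeasure (M \<Otimes>\<^sub>M N) (space M \<times> A)"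
      by (auto simp: emeasure_distr space_pair_measure dest: sets.sets_into_space
          intro!: arg_cong2[where f=emeasure])
    with A show "emeasure (distr (M \<Otimes>\<^sub>M N) N snd) A = emeasure N A"
      by (simp add: N.emeasure_pair_measure_Times M.emeasure_space_1)
  qed simp
qed

text \<open>A product of measure preserving maps preserves the product measure. Besides the diagonal
  action this covers the projections that forget one of two \<open>X\<close>-coordinates, so that a
  relation on \<open>X \<times> Y\<close> can be read at either point of a pair.\<close>

lemma AE_pair_map:
  assumes f: "f \<in> measurable M' M" "distr M' M f = M" and g: "g \<in> measurable N' N" "distr N' N g = N"
    and N: "prob_space N" and P: "AE t in M \<Otimes>\<^sub>M N. P t"
  shows "AE t in M' \<Otimes>\<^sub>M N'. P (f (fst t), g (snd t))"
proof -
  interpret N: prob_space N by fact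
  have eq: "distr (M' \<Otimes>\<^sub>M N') (M \<Otimes>\<^sub>M N) (\<lambda>(x, y). (f x, g y)) = M \<Otimes>\<^sub>M N"
    using pair_measure_distr[OF f(1) g(1)] f(2) g(2) N.sigma_finite_measure_axioms by simp
  have "(\<lambda>(x, y). (f x, g y)) \<in> measurable (M' \<Otimes>\<^sub>M N') (M \<Otimes>\<^sub>M N)"
    using f(1) g(1) by measurable
  from AE_distrD[OF this, of P] show ?thesis using P unfolding eq by (simp add: case_prod_unfold)
qed

text \<open>Fubini for null sets, which asks no measurability of \<open>P\<close>: the iterated
  statement does not depend on the outer variable.\<close>

lemma AE_pair_snd:
  assumes "prob_space M" "prob_space N" "AE t in M \<Otimes>\<^sub>M N. P (snd t)"
  shows "AE y in N. P y"
proof -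
  interpret M: prob_space M by fact
  interpret N: prob_space N by fact
  interpret pair_prob_space M N ..
  have "AE x in M. AE y in N. P y" using AE_pair[OF assms(3)] by simp
  then show ?thesis by simp
qed

lemma AE_pair_fst:
  assumes "prob_space M" "prob_space N" "AE t in M \<Otimes>\<^sub>M N. P (fst t)"
  shows "AE x in M. P x"
proof -
  interpret M: prob_space M by fact
  interpret N: prob_space N by fact
  interpret pair_prob_space M N ..
  have "AE x in M. AE y in N. P x" using AE_pair[OF assms(3)] by simp
  then show ?thesis by simp
qed

context topological_group
begin

lemma measurable_mult:
  "\<lbrakk>second_countable T; f \<in> measurable R (borel_of T); g \<in> measurable R (borel_of T)\<rbrakk> \<Longrightarrow>
    (\<lambda>t. f t \<otimes> g t) \<in> measurable R (borel_of T)"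
  by (rule measurable_borel_of_continuous2[OF _ _ _ continuous_mult])

lemma measurable_m_inv:
  "f \<in> measurable R (borel_of T) \<Longrightarrow> (\<lambda>t. inv (f t)) \<in> measurable R (borel_of T)"
  by (rule measurable_borel_of_continuous[OF _ continuous_inv])

lemma measurable_carrier:
  "\<lbrakk>f \<in> measurable R (borel_of T); t \<in> space R\<rbrakk> \<Longrightarrow> f t \<in> carrier W"
  using measurable_space[of f R "borel_of T" t] by (simp add: topspace_carrier)

text \<open>In terms of right cosets, \<open>V u\<close> is equivariant up to the right factor
  \<open>r g\<close>, which does not see the \<open>X\<close>-variable, and the conclusion is that
  \<open>V u\<close> does not see it either. A point \<open>s\<close> is returned as witness because
  the section of \<open>u\<close> at \<open>s\<close> is automatically measurable.\<close>

lemma coset_map_constant: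
  fixes G :: "'g monoid" and M :: "'x measure" and N :: "'y measure"
  assumes G: "group G" and M: "prob_space M" and N: "prob_space N"
    and \<sigma>: "mp_action G M \<sigma>" and \<rho>: "mp_action G N \<rho>" and mixing: "weakly_mixing G M \<sigma>"
    and T: "second_countable T" and small: "small_invariant_nhds W T"
    and V: "subgroup V W" and closed: "closedin T V"
    and u: "u \<in> measurable (M \<Otimes>\<^sub>M N) (borel_of T)"
    and equivariant: "\<And>g. g \<in> carrier G \<Longrightarrow> AE t in M \<Otimes>\<^sub>M N. r g (snd t) \<in> carrier W \<and>
      (\<exists>v\<in>V. u (\<sigma> (inv\<^bsub>G\<^esub> g) (fst t), \<rho> (inv\<^bsub>G\<^esub> g) (snd t)) = v \<otimes> u t \<otimes> r g (snd t))"
  obtains s where "s \<in> space M" "AE t in M \<Otimes>\<^sub>M N. u t \<otimes> inv (u (s, snd t)) \<in> V"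
proof -
  interpret M: prob_space M by fact
  interpret N: prob_space N by fact
  interpret V: subgroup V W by fact
  interpret MM: pair_prob_space M M ..
  interpret MN: pair_prob_space M N ..
  let ?Z = "M \<Otimes>\<^sub>M M"
  let ?R = "?Z \<Otimes>\<^sub>M N"
  have Z: "prob_space ?Z" by (rule MM.P.prob_space_axioms)
  interpret ZN: pair_prob_space ?Z N ..
  define a where "a g = (\<lambda>(x, x'). (\<sigma> (inv\<^bsub>G\<^esub> g) x, \<sigma> (inv\<^bsub>G\<^esub> g) x'))" for g
  define b where "b g = \<rho> (inv\<^bsub>G\<^esub> g)" for g
  note \<sigma>_meas [measurable] = mp_action_measurable[OF G \<sigma>]
  note \<sigma>_distr = mp_action_distr[OF G \<sigma>]
  have a_meas: "a g \<in> measurable ?Z ?Z" if [simp]: "g \<in> carrier G" for g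
    unfolding a_def by measurable
  have a_distr: "distr ?Z ?Z (a g) = ?Z" if g: "g \<in> carrier G" for g
    unfolding a_def using pair_measure_distr[OF \<sigma>_meas[OF g] \<sigma>_meas[OF g]] \<sigma>_distr[OF g]
      M.sigma_finite_measure_axioms by simp
  have b_meas: "b g \<in> measurable N N" and b_distr: "distr N N (b g) = N" if "g \<in> carrier G" for g
    using mp_action_measurable[OF G \<rho> that] mp_action_distr[OF G \<rho> that] by (simp_all add: b_def)
  define q where "q p = u (fst (fst p), snd p) \<otimes> inv (u (snd (fst p), snd p))" for p
  have u1: "(\<lambda>p. u (fst (fst p), snd p)) \<in> measurable ?R (borel_of T)"
    and u2: "(\<lambda>p. u (snd (fst p), snd p)) \<in> measurable ?R (borel_of T)"
    by (rule measurable_compose[OF _ u], measurable)+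
  have q: "q \<in> measurable ?R (borel_of T)"
    unfolding q_def by (rule measurable_mult[OF T u1 measurable_m_inv[OF u2]])
  obtain \<Phi> where \<Phi>: "\<Phi> \<noteq> bot" "\<forall>\<^sub>F g in \<Phi>. g \<in> carrier G"
    and mix: "\<And>A B. \<lbrakk>A \<in> sets M; B \<in> sets M\<rbrakk> \<Longrightarrow>
      ((\<lambda>g. measure M (A \<inter> \<sigma> g ` B)) \<longlongrightarrow> measure M A * measure M B) \<Phi>"
    using weakly_mixing_filter[OF mixing] by blast
  define \<G> where "\<G> = {A \<times> B | A B. A \<in> sets M \<and> B \<in> sets M}"
  have gen: "sets ?Z = sigma_sets (space ?Z) \<G>" "Int_stable \<G>" "\<G> \<subseteq> Pow (space ?Z)" "space ?Z \<in> \<G>"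
    unfolding \<G>_def space_pair_measure
    by (rule sets_pair_measure Int_stable_pair_measure_generator pair_measure_closed)+ auto
  \<comment> \<open>The same \<open>g\<close> acts on both coordinates, so the correlation of
    rectangles is a product of two correlations in \<open>M\<close> that converge along the same
    filter.\<close>
  have mixZ: "((\<lambda>g. measure ?Z (P \<inter> (a g -` Q \<inter> space ?Z))) \<longlongrightarrow> measure ?Z P * measure ?Z Q) \<Phi>"
    if PQ: "P \<in> \<G>" "Q \<in> \<G>" for P Q
  proof -
    from PQ obtain A B A' B' where P: "P = A \<times> B" and Q: "Q = A' \<times> B'"
      and sets: "A \<in> sets M" "B \<in> sets M" "A' \<in> sets M" "B' \<in> sets M"
      unfolding \<G>_def by blast
    have ev: "\<forall>\<^sub>F g in \<Phi>. measure M (A \<inter> \<sigma> g ` A') * measure M (B \<inter> \<sigma> g ` B')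
        = measure ?Z (P \<inter> (a g -` Q \<inter> space ?Z))"
      using \<Phi>(2)
    proof eventually_elim
      fix g assume g: "g \<in> carrier G"
      have im: "\<sigma> g ` C = \<sigma> (inv\<^bsub>G\<^esub> g) -` C \<inter> space M" "\<sigma> g ` C \<in> sets M" if "C \<in> sets M" for C
        using mp_action_image[OF G \<sigma> g sets.sets_into_space[OF that]]
          measurable_sets[OF \<sigma>_meas[OF g] that] by simp_all
      have "P \<inter> (a g -` Q \<inter> space ?Z) = (A \<inter> \<sigma> g ` A') \<times> (B \<inter> \<sigma> g ` B')"
        by (auto simp: P Q im(1) sets a_def space_pair_measure)
      then show "measure M (A \<inter> \<sigma> g ` A') * measure M (B \<inter> \<sigma> g ` B')
          = measure ?Z (P \<inter> (a g -` Q \<inter> space ?Z))"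
        using measure_Times[OF M M, of "A \<inter> \<sigma> g ` A'" "B \<inter> \<sigma> g ` B'"] sets im(2) by simp
    qed
    have lim: "((\<lambda>g. measure M (A \<inter> \<sigma> g ` A') * measure M (B \<inter> \<sigma> g ` B'))
        \<longlongrightarrow> (measure M A * measure M A') * (measure M B * measure M B')) \<Phi>"
      by (intro tendsto_mult mix sets)
    have eq: "(measure M A * measure M A') * (measure M B * measure M B') = measure ?Z P * measure ?Z Q"
      by (simp add: P Q measure_Times[OF M M] sets)
    show ?thesis using Lim_transform_eventually[OF lim ev] unfolding eq .
  qed
  obtain \<O> where \<O>: "countable \<O>" "\<And>Q. Q \<in> \<O> \<Longrightarrow> openin T Q \<and> \<one> \<in> Q"
    and biinv: "\<And>Q a b p. \<lbrakk>Q \<in> \<O>; a \<in> V; b \<in> V; p \<in> carrier W\<rbrakk> \<Longrightarrow> a \<otimes> p \<otimes> b \<in> Q \<longleftrightarrow> p \<in> Q"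
    and sep: "\<And>p. \<lbrakk>p \<in> carrier W; p \<notin> V\<rbrakk> \<Longrightarrow> \<exists>Q\<in>\<O>. p \<notin> Q"
    using biinvariant_nhds[OF T small V closed] by blast
  have AE_Q: "AE p in ?R. q p \<in> Q" if Q: "Q \<in> \<O>" for Q
  proof -
    define E where "E = {p \<in> space ?R. q p \<notin> Q}"
    have "q -` Q \<inter> space ?R \<in> sets ?R"
      by (rule measurable_sets[OF q]) (use \<O>(2)[OF Q] in auto)
    then have "space ?R - (q -` Q \<inter> space ?R) \<in> sets ?R" by auto
    moreover have "space ?R - (q -` Q \<inter> space ?R) = E" by (auto simp: E_def)
    ultimately have E: "E \<in> sets ?R" by simp
    \<comment> \<open>The factor \<open>r g y\<close> cancels between the two values of
      \<open>u\<close>, and \<open>q\<close> changes to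
      \<open>v \<otimes> q p \<otimes> inv v'\<close>, which lies in \<open>Q\<close> exactly when
      \<open>q p\<close> does.\<close>
    have inv: "AE (z, y) in ?R. (a g z, b g y) \<in> E \<longleftrightarrow> (z, y) \<in> E" if g: "g \<in> carrier G" for g
    proof -
      let ?good = "\<lambda>t. r g (snd t) \<in> carrier W \<and>
        (\<exists>v\<in>V. u (\<sigma> (inv\<^bsub>G\<^esub> g) (fst t), \<rho> (inv\<^bsub>G\<^esub> g) (snd t)) = v \<otimes> u t \<otimes> r g (snd t))"
      have "AE p in ?R. ?good (fst (fst p), snd p)"
        using AE_pair_map[OF measurable_fst M.distr_pair_fst measurable_ident_sets[OF refl] distr_id N
            equivariant[OF g]] by simp
      moreover have "AE p in ?R. ?good (snd (fst p), snd p)"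
        using AE_pair_map[OF measurable_snd distr_pair_snd[OF M M] measurable_ident_sets[OF refl] distr_id N
            equivariant[OF g]] by simp
      moreover have "AE p in ?R. p \<in> space ?R" by (rule AE_space)
      ultimately show ?thesis
      proof eventually_elim
        case (elim p)
        obtain x x' y where p: "p = ((x, x'), y)" by (metis surj_pair)
        have space: "x \<in> space M" "x' \<in> space M" "y \<in> space N"
          using elim by (auto simp: p space_pair_measure)
        obtain v v' where v: "v \<in> V" "v' \<in> V" and r: "r g y \<in> carrier W"
          and eq: "u (\<sigma> (inv\<^bsub>G\<^esub> g) x, b g y) = v \<otimes> u (x, y) \<otimes> r g y"
            "u (\<sigma> (inv\<^bsub>G\<^esub> g) x', b g y) = v' \<otimes> u (x', y) \<otimes> r g y"
          using elim by (auto simp: p b_def)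
        have carr: "u (x, y) \<in> carrier W" "u (x', y) \<in> carrier W" "v \<in> carrier W" "v' \<in> carrier W"
          using measurable_carrier[OF u] space v by (auto simp: space_pair_measure)
        have "q ((\<sigma> (inv\<^bsub>G\<^esub> g) x, \<sigma> (inv\<^bsub>G\<^esub> g) x'), b g y) = v \<otimes> q p \<otimes> inv v'"
        proof -
          have "r g y \<otimes> (inv (r g y) \<otimes> (inv (u (x', y)) \<otimes> inv v')) = inv (u (x', y)) \<otimes> inv v'"
            using r carr by (simp add: m_assoc[symmetric])
          then show ?thesis using r carr by (simp add: q_def p eq inv_mult_group m_assoc)
        qed
        moreover have "q p \<in> carrier W" using carr by (simp add: q_def p)
        ultimately have "q ((\<sigma> (inv\<^bsub>G\<^esub> g) x, \<sigma> (inv\<^bsub>G\<^esub> g) x'), b g y) \<in> Q \<longleftrightarrow> q p \<in> Q"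
          using biinv[OF Q v(1) V.m_inv_closed[OF v(2)]] by simp
        moreover have "((\<sigma> (inv\<^bsub>G\<^esub> g) x, \<sigma> (inv\<^bsub>G\<^esub> g) x'), b g y) \<in> space ?R"
          using space measurable_space[OF \<sigma>_meas[OF g]] measurable_space[OF b_meas[OF g]]
          by (simp add: space_pair_measure)
        ultimately show ?case using space by (simp add: p E_def a_def space_pair_measure)
      qed
    qed
    have fibres: "AE y in N. measure ?Z ((\<lambda>z. (z, y)) -` E) \<in> {0, 1}"
      by (rule mixing_invariant_fibres[OF Z N \<Phi> a_meas a_distr b_meas b_distr gen mixZ E inv])
    \<comment> \<open>If \<open>x\<close> and \<open>x'\<close> lie in the same \<open>B C\<close>,
      then \<open>q\<close> has its value in \<open>Q\<close>. Hence the fibre of \<open>E\<close>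
      misses the square of \<open>B C\<close>, which has positive measure for a suitable
      \<open>C\<close> in the countable cover.\<close>
    have not_one: "measure ?Z ((\<lambda>z. (z, y)) -` E) \<noteq> 1" if y: "y \<in> space N" for y
    proof -
      obtain \<C> where \<C>: "countable \<C>" "\<And>C. C \<in> \<C> \<Longrightarrow> openin T C" "\<Union>\<C> = carrier W"
        and small_C: "\<And>C x y. \<lbrakk>C \<in> \<C>; x \<in> C; y \<in> C\<rbrakk> \<Longrightarrow> x \<otimes> inv y \<in> Q"
        using countable_small_cover[OF T] \<O>(2)[OF Q] by metis
      define B where "B C = (\<lambda>x. u (x, y)) -` C \<inter> space M" for C
      have uy: "(\<lambda>x. u (x, y)) \<in> measurable M (borel_of T)"
        by (rule measurable_compose[OF measurable_Pair2'[OF y] u])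
      have B: "B C \<in> sets M" if "C \<in> \<C>" for C
        unfolding B_def by (rule measurable_sets[OF uy]) (use \<C>(2)[OF that] in auto)
      have "\<exists>C\<in>\<C>. measure M (B C) \<noteq> 0"
      proof (rule ccontr)
        assume "\<not> ?thesis"
        then have "B C \<in> null_sets M" if "C \<in> \<C>" for C
          using that B by (auto simp: null_sets_def M.emeasure_eq_measure)
        then have "(\<Union>C\<in>\<C>. B C) \<in> null_sets M" by (intro null_sets_UN' \<C>(1))
        moreover have "(\<Union>C\<in>\<C>. B C) = space M"
          using \<C>(3) measurable_carrier[OF uy] by (fastforce simp: B_def)
        ultimately show False using M.emeasure_space_1 by (simp add: null_sets_def)
      qed
      then obtain C where C: "C \<in> \<C>" "measure M (B C) \<noteq> 0" by blast
      have BB: "B C \<times> B C \<in> sets ?Z" using B[OF C(1)] by simp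
      have "(\<lambda>z. (z, y)) -` E \<subseteq> space ?Z - B C \<times> B C"
        using small_C[OF C(1)] by (auto simp: E_def B_def q_def space_pair_measure)
      then have "measure ?Z ((\<lambda>z. (z, y)) -` E) \<le> measure ?Z (space ?Z - B C \<times> B C)"
        by (rule MM.P.finite_measure_mono) (use BB in auto)
      also have "\<dots> = 1 - measure M (B C) * measure M (B C)"
        using MM.P.prob_compl[OF BB] measure_Times[OF M M B[OF C(1)] B[OF C(1)]] by simp
      also have "\<dots> < 1" using C(2) by (simp add: zero_less_mult_iff zero_less_measure_iff)
      finally show ?thesis by simp
    qed
    have "AE y in N. measure ?Z ((\<lambda>z. (z, y)) -` E) = 0"
      using fibres AE_space[of N] by eventually_elim (use not_one in auto)
    then have "(\<integral>y. measure ?Z ((\<lambda>z. (z, y)) -` E) \<partial>N) = 0" by (rule integral_eq_zero_AE)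
    then have "measure ?R E = 0" using integral_section[OF Z N E] by simp
    then have "E \<in> null_sets ?R" using E by (simp add: null_sets_def ZN.P.emeasure_eq_measure)
    then have "AE p in ?R. p \<notin> E" by (rule AE_not_in)
    then show ?thesis using AE_space[of ?R] by eventually_elim (simp add: E_def)
  qed
  \<comment> \<open>Countability of \<open>\<O>\<close> unites the exceptional null sets; a group
    element in all members of \<open>\<O>\<close> belongs to \<open>V\<close>.\<close>
  have "AE p in ?R. \<forall>Q\<in>\<O>. q p \<in> Q" using AE_Q by (subst AE_ball_countable[OF \<O>(1)]) blast
  then have "AE p in ?R. q p \<in> V"
    using AE_space[of ?R] by eventually_elim (use sep measurable_carrier[OF q] in blast)
  then have "AE z in ?Z. AE y in N. q (z, y) \<in> V" by (rule ZN.AE_pair)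
  then have "AE x' in M. AE x in M. AE y in N. q ((x', x), y) \<in> V" by (rule MM.AE_pair)
  \<comment> \<open>Membership in the space is added so that the point extracted from the almost
    everywhere statement is a legitimate base point.\<close>
  then have "AE x' in M. x' \<in> space M \<and> (AE x in M. AE y in N. q ((x', x), y) \<in> V)"
    using AE_space[of M] by eventually_elim simp
  from eventually_happens'[OF M.ae_filter_bot this]
  obtain s where s: "s \<in> space M" "AE x in M. AE y in N. q ((s, x), y) \<in> V" by blast
  show ?thesis
  proof (rule that[OF s(1)])
    have us: "(\<lambda>t. u (s, snd t)) \<in> measurable (M \<Otimes>\<^sub>M N) (borel_of T)"
      by (rule measurable_compose[OF measurable_snd measurable_compose[OF measurable_Pair1'[OF s(1)] u]])
    \<comment> \<open>The way back from an iterated to a product almost everywhere statement asks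
      for a measurable set; \<open>V\<close> is Borel because it is closed.\<close>
    have "(\<lambda>t. u t \<otimes> inv (u (s, snd t))) -` V \<inter> space (M \<Otimes>\<^sub>M N) \<in> sets (M \<Otimes>\<^sub>M N)"
      by (rule measurable_sets[OF measurable_mult[OF T u measurable_m_inv[OF us]] borel_of_closed[OF closed]])
    moreover have "(\<lambda>t. u t \<otimes> inv (u (s, snd t))) -` V \<inter> space (M \<Otimes>\<^sub>M N)
        = {t \<in> space (M \<Otimes>\<^sub>M N). u t \<otimes> inv (u (s, snd t)) \<in> V}" by auto
    ultimately have meas: "{t \<in> space (M \<Otimes>\<^sub>M N). u t \<otimes> inv (u (s, snd t)) \<in> V} \<in> sets (M \<Otimes>\<^sub>M N)"
      by simp
    have "AE x in M. AE y in N. u (x, y) \<otimes> inv (u (s, snd (x, y))) \<in> V"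
      using s(2) AE_space[of M]
    proof eventually_elim
      case (elim x)
      show ?case
        using elim(1) AE_space[of N]
      proof eventually_elim
        case (elim y)
        have "u (x, y) \<in> carrier W" "u (s, y) \<in> carrier W"
          using measurable_carrier[OF u] elim s \<open>x \<in> space M\<close> by (auto simp: space_pair_measure)
        then have "inv (q ((s, x), y)) = u (x, y) \<otimes> inv (u (s, y))"
          by (simp add: q_def inv_mult_group)
        then show ?case using V.m_inv_closed[OF elim(1)] by simp
      qed
    qed
    then show "AE t in M \<Otimes>\<^sub>M N. u t \<otimes> inv (u (s, snd t)) \<in> V"
      by (rule MN.AE_pair_measure[OF meas])
  qed
qed

end

section \<open>Untwisting in the subgroup\<close>

context topological_group
begin

text \<open>Corrects a map that takes values in \<open>V\<close> only almost everywhere.\<close>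

definition retract :: "'w set \<Rightarrow> 'w \<Rightarrow> 'w" where
  "retract V x = (if x \<in> V then x else \<one>)"

lemma retract_mem: "subgroup V W \<Longrightarrow> retract V x \<in> V"
  by (simp add: retract_def subgroup.one_closed)

lemma retract_id: "x \<in> V \<Longrightarrow> retract V x = x"
  by (simp add: retract_def)

lemma measurable_retract:
  assumes V: "subgroup V W" and closed: "closedin T V" and f: "f \<in> measurable R (borel_of T)"
  shows "(\<lambda>t. retract V (f t)) \<in> measurable R (borel_of (subtopology T V))"
proof -
  have "f -` V \<inter> space R \<in> sets R" by (rule measurable_sets[OF f borel_of_closed[OF closed]])
  then have "{t \<in> space R. f t \<in> V} \<in> sets R" by (simp add: vimage_def Collect_conj_eq Int_commute)
  moreover have "(\<lambda>_. \<one>) \<in> measurable R (borel_of T)"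
    by (rule measurable_const) (simp add: topspace_carrier)
  ultimately have "(\<lambda>t. if f t \<in> V then f t else \<one>) \<in> measurable R (borel_of T)"
    by (intro measurable_If f)
  then show ?thesis
    by (simp add: measurable_borel_of_subtopology retract_def subgroup.one_closed[OF V] Pi_iff)
qed

text \<open>The equivalence relation solved for the translated value: \<open>a\<close> and
  \<open>a'\<close> stand for \<open>u\<close> at \<open>t\<close> and at its translate,
  \<open>c\<close> for \<open>w (t, g)\<close>, and the last bracket is the equivalent
  cocycle.\<close>

lemma twist_solve:
  assumes "a \<in> carrier W" "a' \<in> carrier W" "c \<in> carrier W"
  shows "a' = inv c \<otimes> a \<otimes> (inv a \<otimes> c \<otimes> a')"
proof -
  have "a \<otimes> (inv a \<otimes> (c \<otimes> a')) = c \<otimes> a'" "inv c \<otimes> (c \<otimes> a') = a'"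
    using assms by (simp_all add: m_assoc[symmetric])
  then show ?thesis using assms by (simp add: m_assoc)
qed

text \<open>Correcting the conjugating map by \<open>inv e\<close> on the right twists the resulting
  cocycle by \<open>e\<close>.\<close>

lemma twist_translate:
  assumes "a \<in> carrier W" "a' \<in> carrier W" "c \<in> carrier W" "e \<in> carrier W" "e' \<in> carrier W"
  shows "inv (a \<otimes> inv e) \<otimes> c \<otimes> (a' \<otimes> inv e') = e \<otimes> (inv a \<otimes> c \<otimes> a') \<otimes> inv e'"
  using assms by (simp add: m_assoc inv_mult_group)

text \<open>The inner factors telescope: a cocycle twisted by \<open>e\<close> satisfies the cocycle
  identity again, and for constant \<open>e\<close> a morphism remains a morphism.\<close>

lemma translate_mult:
  assumes "d \<in> carrier W" "d' \<in> carrier W" "e \<in> carrier W" "e' \<in> carrier W" "e'' \<in> carrier W"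
  shows "(e \<otimes> d \<otimes> inv e') \<otimes> (e' \<otimes> d' \<otimes> inv e'') = e \<otimes> (d \<otimes> d') \<otimes> inv e''"
proof -
  have "inv e' \<otimes> (e' \<otimes> (d' \<otimes> inv e'')) = d' \<otimes> inv e''"
    using assms by (simp add: m_assoc[symmetric])
  then show ?thesis using assms by (simp add: m_assoc)
qed

text \<open>\<open>V\<close>-valuedness is encoded in the measurability condition, whose target
  space lies in \<open>V\<close>. It therefore holds at every point and not only almost
  everywhere.\<close>

lemma cocycle_subgroup_mem:
  assumes "cocycle G M \<sigma> (W\<lparr>carrier := V\<rparr>) (subtopology T V) w" "t \<in> space M" "g \<in> carrier G"
  shows "w (t, g) \<in> V"
proof -
  have "w \<in> measurable (M \<Otimes>\<^sub>M count_space (carrier G)) (borel_of (subtopology T V))"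
    using assms(1) unfolding cocycle_def by (rule conjunct1)
  from measurable_space[OF this, of "(t, g)"] assms(2,3) show ?thesis
    by (simp add: space_pair_measure)
qed

text \<open>The second factor plays a dummy role here: \<open>M\<close> with \<open>\<sigma>\<close>
  itself takes the place of \<open>N\<close>, and \<open>u\<close> is composed with the first
  projection. The element \<open>e\<close> found is then constant, and conjugation by it moves the
  morphism into \<open>V\<close>.\<close>

lemma untwistable_subgroup:
  fixes G :: "'g monoid" and M :: "'x measure"
  assumes G: "group G" and M: "prob_space M"
    and \<sigma>: "mp_action G M \<sigma>" and mixing: "weakly_mixing G M \<sigma>"
    and T: "second_countable T" and small: "small_invariant_nhds W T"
    and V: "subgroup V W" and closed: "closedin T V"
    and w: "cocycle G M \<sigma> (W\<lparr>carrier := V\<rparr>) (subtopology T V) w"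
    and untwist: "untwistable G M \<sigma> W T w"
  shows "untwistable G M \<sigma> (W\<lparr>carrier := V\<rparr>) (subtopology T V) w"
proof -
  interpret M: prob_space M by fact
  interpret V: subgroup V W by fact
  interpret G: group G by fact
  obtain \<pi> u where \<pi>: "\<pi> \<in> hom G W" and u: "u \<in> measurable M (borel_of T)"
    and eq: "\<And>g. g \<in> carrier G \<Longrightarrow>
      AE t in M. \<pi> g = inv (u t) \<otimes> w (t, g) \<otimes> u (\<sigma> (inv\<^bsub>G\<^esub> g) t)"
    using untwist unfolding untwistable_def cocycle_equiv_def by auto
  have \<pi>_carr: "\<pi> g \<in> carrier W" if "g \<in> carrier G" for g using \<pi> that by (auto simp: hom_def)
  have u_carr: "u x \<in> carrier W" if "x \<in> space M" for x using measurable_carrier[OF u that] .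
  note \<sigma>_meas = mp_action_measurable[OF G \<sigma>]
  note \<sigma>_space = measurable_space[OF \<sigma>_meas]
  note wV = cocycle_subgroup_mem[OF w]
  have equivariant: "AE p in M \<Otimes>\<^sub>M M. \<pi> g \<in> carrier W \<and>
      (\<exists>v\<in>V. u (fst (\<sigma> (inv\<^bsub>G\<^esub> g) (fst p), \<sigma> (inv\<^bsub>G\<^esub> g) (snd p))) = v \<otimes> u (fst p) \<otimes> \<pi> g)"
    if g: "g \<in> carrier G" for g
  proof -
    have "AE t in M. \<pi> g \<in> carrier W \<and> (\<exists>v\<in>V. u (\<sigma> (inv\<^bsub>G\<^esub> g) t) = v \<otimes> u t \<otimes> \<pi> g)"
      using eq[OF g] AE_space[of M]
    proof eventually_elim
      case (elim t)
      have "u (\<sigma> (inv\<^bsub>G\<^esub> g) t) = inv (w (t, g)) \<otimes> u t \<otimes> \<pi> g"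
        unfolding elim(1) using elim(2) g wV[of t g] by (intro twist_solve u_carr \<sigma>_space) auto
      then show ?case using wV[OF elim(2) g] \<pi>_carr[OF g] by blast
    qed
    then have "AE t in distr (M \<Otimes>\<^sub>M M) M fst.
        \<pi> g \<in> carrier W \<and> (\<exists>v\<in>V. u (\<sigma> (inv\<^bsub>G\<^esub> g) t) = v \<otimes> u t \<otimes> \<pi> g)"
      by (simp only: M.distr_pair_fst)
    from AE_distrD[OF measurable_fst this] show ?thesis by (simp only: fst_conv)
  qed
  obtain s where s: "s \<in> space M" and AE_V: "AE p in M \<Otimes>\<^sub>M M. u (fst p) \<otimes> inv (u (fst (s, snd p))) \<in> V"
    using coset_map_constant[OF G M M \<sigma> \<sigma> mixing T small V closed
        measurable_compose[OF measurable_fst u] equivariant] by blast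
  define e where "e = u s"
  have e: "e \<in> carrier W" using u_carr[OF s] by (simp add: e_def)
  have uV: "AE x in M. u x \<otimes> inv e \<in> V"
    using AE_V by (intro AE_pair_fst[OF M M]) (simp add: e_def)
  define f where "f x = retract V (u x \<otimes> inv e)" for x
  have f: "f \<in> measurable M (borel_of (subtopology T V))"
    unfolding f_def by (intro measurable_retract V closed measurable_mult T u measurable_const)
      (simp add: topspace_carrier e)
  define \<pi>' where "\<pi>' g = e \<otimes> \<pi> g \<otimes> inv e" for g
  have fV: "f x \<in> V" for x unfolding f_def by (rule retract_mem[OF V])
  have eq': "AE x in M. \<pi>' g = inv (f x) \<otimes> w (x, g) \<otimes> f (\<sigma> (inv\<^bsub>G\<^esub> g) x)" if g: "g \<in> carrier G" for g
  proof -
    have "AE x in M. u (\<sigma> (inv\<^bsub>G\<^esub> g) x) \<otimes> inv e \<in> V"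
      by (rule AE_distrD[OF \<sigma>_meas[OF g]]) (subst mp_action_distr[OF G \<sigma> g], rule uV)
    then show ?thesis using uV eq[OF g] AE_space[of M]
    proof eventually_elim
      case (elim x)
      have "inv (u x \<otimes> inv e) \<otimes> w (x, g) \<otimes> (u (\<sigma> (inv\<^bsub>G\<^esub> g) x) \<otimes> inv e) = \<pi>' g"
        unfolding \<pi>'_def elim(3)
        by (rule twist_translate) (use e elim(4) g wV[of x g] u_carr \<sigma>_space in auto)
      then show ?case using elim by (simp add: f_def retract_id)
    qed
  qed
  have "\<pi>' g \<in> V" if g: "g \<in> carrier G" for g
  proof -
    \<comment> \<open>For almost every \<open>x\<close> the element is a product of members of
      \<open>V\<close>. As the claim does not mention \<open>x\<close> and a probability space is
      not null, it holds outright.\<close>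
    have "AE x in M. \<pi>' g \<in> V"
      using eq'[OF g] AE_space[of M]
      by eventually_elim (use g wV fV in \<open>metis V.m_closed V.m_inv_closed\<close>)
    then show ?thesis by simp
  qed
  moreover have "\<pi>' (g \<otimes>\<^bsub>G\<^esub> h) = \<pi>' g \<otimes> \<pi>' h" if "g \<in> carrier G" "h \<in> carrier G" for g h
    unfolding \<pi>'_def using translate_mult[of "\<pi> g" "\<pi> h" e e e] \<pi> \<pi>_carr that e by (simp add: hom_mult)
  ultimately have "\<pi>' \<in> hom G (W\<lparr>carrier := V\<rparr>)" by (auto simp: hom_def)
  moreover have "cocycle_equiv G M \<sigma> (W\<lparr>carrier := V\<rparr>) (subtopology T V) w (\<lambda>(t, g). \<pi>' g)"
    unfolding cocycle_equiv_def using f eq' by (intro bexI[of _ f] ballI) (simp_all add: m_inv_consistent[OF V fV])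
  ultimately show ?thesis unfolding untwistable_def by blast
qed

text \<open>The section \<open>e\<close> of \<open>u\<close> at \<open>s\<close> is a function on
  \<open>Y\<close> alone, so twisting \<open>w'\<close> by it gives again a cocycle for
  \<open>\<rho>\<close>, while \<open>u\<close> corrected by \<open>e\<close> lies in
  \<open>V\<close> almost everywhere. That the twisted cocycle is \<open>V\<close>-valued is visible
  on the product, where it is conjugate to \<open>w\<close> by a \<open>V\<close>-valued
  map.\<close>

lemma equiv_to_snd_cocycle_subgroup:
  fixes G :: "'g monoid" and M :: "'x measure" and N :: "'y measure"
  assumes G: "group G" and countable: "countable (carrier G)" and M: "prob_space M" and N: "prob_space N"
    and \<sigma>: "mp_action G M \<sigma>" and \<rho>: "mp_action G N \<rho>" and mixing: "weakly_mixing G M \<sigma>"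
    and T: "second_countable T" and small: "small_invariant_nhds W T"
    and V: "subgroup V W" and closed: "closedin T V"
    and w: "cocycle G (M \<Otimes>\<^sub>M N) (diag_action M N \<sigma> \<rho>) (W\<lparr>carrier := V\<rparr>) (subtopology T V) w"
    and equiv: "equiv_to_snd_cocycle G M N \<sigma> \<rho> W T w"
  shows "equiv_to_snd_cocycle G M N \<sigma> \<rho> (W\<lparr>carrier := V\<rparr>) (subtopology T V) w"
proof -
  interpret M: prob_space M by fact
  interpret N: prob_space N by fact
  interpret V: subgroup V W by fact
  interpret G: group G by fact
  let ?P = "M \<Otimes>\<^sub>M N"
  define \<theta> where "\<theta> g t = (\<sigma> (inv\<^bsub>G\<^esub> g) (fst t), \<rho> (inv\<^bsub>G\<^esub> g) (snd t))" for g t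
  have diag: "diag_action M N \<sigma> \<rho> (inv\<^bsub>G\<^esub> g) t = \<theta> g t" if "t \<in> space ?P" for g t
    using that by (cases t) (simp add: diag_action_def \<theta>_def)
  obtain w' u where w': "cocycle G N \<rho> W T w'" and u: "u \<in> measurable ?P (borel_of T)"
    and eq0: "\<And>g. g \<in> carrier G \<Longrightarrow> AE t in ?P.
      lift_snd w' (t, g) = inv (u t) \<otimes> w (t, g) \<otimes> u (diag_action M N \<sigma> \<rho> (inv\<^bsub>G\<^esub> g) t)"
    using equiv unfolding equiv_to_snd_cocycle_def cocycle_equiv_def by blast
  have eq: "AE t in ?P. w' (snd t, g) = inv (u t) \<otimes> w (t, g) \<otimes> u (\<theta> g t)" if g: "g \<in> carrier G" for g
    using eq0[OF g] AE_space[of ?P]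
    by eventually_elim (auto simp: diag lift_snd_def case_prod_unfold)
  have w'_meas: "(\<lambda>y. w' (y, g)) \<in> measurable N (borel_of T)" if "g \<in> carrier G" for g
  proof (rule measurable_compose[OF measurable_Pair2'])
    show "w' \<in> measurable (N \<Otimes>\<^sub>M count_space (carrier G)) (borel_of T)"
      using w' unfolding cocycle_def by (rule conjunct1)
  qed (use that in simp)
  note \<sigma>_meas = mp_action_measurable[OF G \<sigma>] and \<rho>_meas = mp_action_measurable[OF G \<rho>]
  have u_carr: "u t \<in> carrier W" if "t \<in> space ?P" for t using measurable_carrier[OF u that] .
  have w'_carr: "w' (y, g) \<in> carrier W" if "y \<in> space N" "g \<in> carrier G" for y g
    using measurable_carrier[OF w'_meas] that by blast
  have \<theta>_space: "\<theta> g t \<in> space ?P" if "g \<in> carrier G" "t \<in> space ?P" for g t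
    using that measurable_space[OF \<sigma>_meas] measurable_space[OF \<rho>_meas]
    by (auto simp: \<theta>_def space_pair_measure)
  note wV = cocycle_subgroup_mem[OF w]
  have snd_space: "snd t \<in> space N" if "t \<in> space ?P" for t using that by (auto simp: space_pair_measure)
  have equivariant: "AE t in ?P. w' (snd t, g) \<in> carrier W \<and>
      (\<exists>v\<in>V. u (\<sigma> (inv\<^bsub>G\<^esub> g) (fst t), \<rho> (inv\<^bsub>G\<^esub> g) (snd t)) = v \<otimes> u t \<otimes> w' (snd t, g))"
    if g: "g \<in> carrier G" for g
    using eq[OF g] AE_space[of ?P]
  proof eventually_elim
    case (elim t)
    have "u (\<theta> g t) = inv (w (t, g)) \<otimes> u t \<otimes> w' (snd t, g)"
      unfolding elim(1) using elim(2) g wV[of t g] by (intro twist_solve u_carr \<theta>_space) auto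
    then show ?case using wV[OF elim(2) g] w'_carr[OF snd_space[OF elim(2)] g] unfolding \<theta>_def by blast
  qed
  obtain s where s: "s \<in> space M" and AE_V: "AE t in ?P. u t \<otimes> inv (u (s, snd t)) \<in> V"
    using coset_map_constant[OF G M N \<sigma> \<rho> mixing T small V closed u, of "\<lambda>g y. w' (y, g)"] equivariant
    by blast
  define e where "e y = u (s, y)" for y
  have e_meas: "e \<in> measurable N (borel_of T)"
    unfolding e_def by (rule measurable_compose[OF measurable_Pair1'[OF s] u])
  have e_carr: "e y \<in> carrier W" if "y \<in> space N" for y using measurable_carrier[OF e_meas that] .
  define f where "f t = retract V (u t \<otimes> inv (e (snd t)))" for t
  have f: "f \<in> measurable ?P (borel_of (subtopology T V))"
    unfolding f_def
    by (intro measurable_retract V closed measurable_mult T u measurable_m_inv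
        measurable_compose[OF measurable_snd e_meas])
  have fV: "f t \<in> V" for t unfolding f_def by (rule retract_mem[OF V])
  define k where "k y g = e y \<otimes> w' (y, g) \<otimes> inv (e (\<rho> (inv\<^bsub>G\<^esub> g) y))" for y g
  have k_meas: "(\<lambda>y. k y g) \<in> measurable N (borel_of T)" if g: "g \<in> carrier G" for g
    unfolding k_def
    by (intro measurable_mult T e_meas w'_meas g measurable_m_inv measurable_compose[OF \<rho>_meas[OF g] e_meas])
  have eq': "AE t in ?P. k (snd t) g = inv (f t) \<otimes> w (t, g) \<otimes> f (\<theta> g t)" if g: "g \<in> carrier G" for g
  proof -
    have "AE t in ?P. u (\<theta> g t) \<otimes> inv (e (snd (\<theta> g t))) \<in> V"
      unfolding \<theta>_def
      by (rule AE_pair_map[OF \<sigma>_meas[OF g] mp_action_distr[OF G \<sigma> g] \<rho>_meas[OF g] mp_action_distr[OF G \<rho> g] N])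
        (use AE_V in \<open>simp add: e_def\<close>)
    then show ?thesis using AE_V eq[OF g] AE_space[of ?P]
    proof eventually_elim
      case (elim t)
      have "inv (u t \<otimes> inv (e (snd t))) \<otimes> w (t, g) \<otimes> (u (\<theta> g t) \<otimes> inv (e (snd (\<theta> g t)))) = k (snd t) g"
        unfolding k_def elim(3) unfolding \<theta>_def snd_conv unfolding \<theta>_def[symmetric]
        using twist_translate[of "u t" "u (\<theta> g t)" "w (t, g)" "e (snd t)" "e (snd (\<theta> g t))"]
          u_carr[OF elim(4)] u_carr[OF \<theta>_space[OF g elim(4)]] wV[OF elim(4) g]
          e_carr[OF snd_space[OF elim(4)]] e_carr[OF snd_space[OF \<theta>_space[OF g elim(4)]]]
        by (simp add: \<theta>_def)
      then show ?case using elim(1,2) by (simp add: f_def retract_id e_def)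
    qed
  qed
  have kV_snd: "AE t in ?P. k (snd t) g \<in> V" if g: "g \<in> carrier G" for g
    using eq'[OF g] AE_space[of ?P]
    by eventually_elim (use g wV fV in \<open>metis V.m_closed V.m_inv_closed\<close>)
  have kV: "AE y in N. k y g \<in> V" if g: "g \<in> carrier G" for g
    by (rule AE_pair_snd[OF M N kV_snd[OF g]])
  \<comment> \<open>For each \<open>g\<close> the values of \<open>k\<close> are in \<open>V\<close>
    off a null set; \<open>retract\<close> makes this hold everywhere and alters nothing
    else.\<close>
  define w'' where "w'' = (\<lambda>(y, g). retract V (k y g))"
  have w''_V: "w'' p \<in> V" for p by (simp add: w''_def case_prod_unfold retract_mem[OF V])
  \<comment> \<open>Because the group is countable, measurability in the pair reduces to
    measurability in \<open>y\<close> for each fixed \<open>g\<close>.\<close>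
  have "w'' \<in> measurable (N \<Otimes>\<^sub>M count_space (carrier G)) (borel_of (subtopology T V))"
  proof (subst measurable_pair_swap_iff, rule measurable_pair_measure_countable1[OF countable])
    fix g assume g: "g \<in> carrier G"
    show "(\<lambda>y. case (g, y) of (x, y) \<Rightarrow> w'' (y, x)) \<in> measurable N (borel_of (subtopology T V))"
      using measurable_retract[OF V closed k_meas[OF g]] by (simp add: w''_def)
  qed
  moreover have "AE y in N. w'' (y, g) \<otimes> w'' (\<rho> (inv\<^bsub>G\<^esub> g) y, h) = w'' (y, g \<otimes>\<^bsub>G\<^esub> h)"
    if g: "g \<in> carrier G" and h: "h \<in> carrier G" for g h
  proof -
    have gh: "g \<otimes>\<^bsub>G\<^esub> h \<in> carrier G" using g h by simp
    \<comment> \<open>Together with the memberships for \<open>g\<close> and for the product of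
      \<open>g\<close> and \<open>h\<close> at \<open>y\<close>, this makes \<open>retract\<close>
      trivial on all three terms of the cocycle identity.\<close>
    have "AE y in N. k (\<rho> (inv\<^bsub>G\<^esub> g) y) h \<in> V"
      by (rule AE_distrD[OF \<rho>_meas[OF g]]) (subst mp_action_distr[OF G \<rho> g], rule kV[OF h])
    moreover have "AE y in N. w' (y, g) \<otimes> w' (\<rho> (inv\<^bsub>G\<^esub> g) y, h) = w' (y, g \<otimes>\<^bsub>G\<^esub> h)"
      using w' g h by (simp add: cocycle_def)
    ultimately show ?thesis using kV[OF g] kV[OF gh] AE_space[of N]
    proof eventually_elim
      case (elim y)
      let ?y = "\<rho> (inv\<^bsub>G\<^esub> g) y"
      have y': "?y \<in> space N" using measurable_space[OF \<rho>_meas[OF g] elim(5)] .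
      have y'': "\<rho> (inv\<^bsub>G\<^esub> h) ?y \<in> space N" using measurable_space[OF \<rho>_meas[OF h] y'] .
      have "k y g \<otimes> k ?y h = k y (g \<otimes>\<^bsub>G\<^esub> h)"
        unfolding k_def elim(2)[symmetric] mp_action_inv_comp[OF G \<rho> g h elim(5), symmetric]
        using translate_mult w'_carr e_carr elim(5) y' y'' g h by simp
      then show ?case using elim by (simp add: w''_def retract_id)
    qed
  qed
  ultimately have "cocycle G N \<rho> (W\<lparr>carrier := V\<rparr>) (subtopology T V) w''"
    by (simp add: cocycle_def)
  moreover have "cocycle_equiv G ?P (diag_action M N \<sigma> \<rho>) (W\<lparr>carrier := V\<rparr>) (subtopology T V) w (lift_snd w'')"
    unfolding cocycle_equiv_def
  proof (rule bexI[OF _ f], rule ballI)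
    fix g assume g: "g \<in> carrier G"
    from kV_snd[OF g] show "AE t in ?P. lift_snd w'' (t, g) = inv\<^bsub>W\<lparr>carrier := V\<rparr>\<^esub> (f t) \<otimes>\<^bsub>W\<lparr>carrier := V\<rparr>\<^esub> w (t, g)
        \<otimes>\<^bsub>W\<lparr>carrier := V\<rparr>\<^esub> f (diag_action M N \<sigma> \<rho> (inv\<^bsub>G\<^esub> g) t)"
      using eq'[OF g] AE_space[of ?P]
    proof eventually_elim
      case (elim t)
      then show ?case
        by (simp add: m_inv_consistent[OF V fV] diag lift_snd_def w''_def case_prod_unfold retract_id)
    qed
  qed
  ultimately show ?thesis unfolding equiv_to_snd_cocycle_def by blast
qed

end

theorem proposition3p5:
  fixes G :: "'g monoid" and M :: "'x measure" and \<sigma> :: "'g \<Rightarrow> 'x \<Rightarrow> 'x"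
    and W :: "'w monoid" and T :: "'w topology" and V :: "'w set"
  assumes "group G" and "countable (carrier G)"
    and "standard_prob_space M" and "mp_action G M \<sigma>" and "weakly_mixing G M \<sigma>"
    and "polish_group W T" and "finite_type TYPE('h::complex_hilbert_space) W T"
    and "subgroup V W" and "closedin T V"
  shows "(\<forall>w. cocycle G M \<sigma> (W\<lparr>carrier := V\<rparr>) (subtopology T V) w \<and>
              untwistable G M \<sigma> W T w
            \<longrightarrow> untwistable G M \<sigma> (W\<lparr>carrier := V\<rparr>) (subtopology T V) w) \<and>
         (\<forall>(N :: 'y measure) \<rho> w.
            standard_prob_space N \<and> mp_action G N \<rho> \<and>
            cocycle G (M \<Otimes>\<^sub>M N) (diag_action M N \<sigma> \<rho>) (W\<lparr>carrier := V\<rparr>) (subtopology T V) w \<and>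
            equiv_to_snd_cocycle G M N \<sigma> \<rho> W T w
            \<longrightarrow> equiv_to_snd_cocycle G M N \<sigma> \<rho> (W\<lparr>carrier := V\<rparr>) (subtopology T V) w)"
proof -
  interpret topological_group W T
    using \<open>polish_group W T\<close>
    by (simp add: polish_group_def topological_group_def topological_group_axioms_def)
  have T: "second_countable T"
    using \<open>polish_group W T\<close> by (intro polish_topology_second_countable) (simp add: polish_group_def)
  have small: "small_invariant_nhds W T"
    by (rule finite_type_small_invariant_nhds[OF group_axioms topspace_carrier]) fact
  have M: "prob_space M" using \<open>standard_prob_space M\<close> by (simp add: standard_prob_space_def)
  show ?thesis
  proof (intro conjI allI impI; elim conjE)
    fix w assume "cocycle G M \<sigma> (W\<lparr>carrier := V\<rparr>) (subtopology T V) w" "untwistable G M \<sigma> W T w"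
    then show "untwistable G M \<sigma> (W\<lparr>carrier := V\<rparr>) (subtopology T V) w"
      by (rule untwistable_subgroup[OF assms(1) M assms(4,5) T small assms(8,9)])
  next
    fix N :: "'y measure" and \<rho> w
    assume "standard_prob_space N" and \<rho>: "mp_action G N \<rho>"
      and w: "cocycle G (M \<Otimes>\<^sub>M N) (diag_action M N \<sigma> \<rho>) (W\<lparr>carrier := V\<rparr>) (subtopology T V) w"
        "equiv_to_snd_cocycle G M N \<sigma> \<rho> W T w"
    then have N: "prob_space N" by (simp add: standard_prob_space_def)
    show "equiv_to_snd_cocycle G M N \<sigma> \<rho> (W\<lparr>carrier := V\<rparr>) (subtopology T V) w"
      by (rule equiv_to_snd_cocycle_subgroup[OF assms(1,2) M N assms(4) \<rho> assms(5) T small assms(8,9) w])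
  qed
qed

end
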